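(* Let $G$ be a finite abelian group and let $p$ be a prime with $p\prec_{2}\exp(G)$. Then $$\mathsf{K}_1(C_{p^{\alpha}}\oplus G)=\mathsf{K}_1(C_{p^{\alpha}})+\mathsf{K}_1(G)$$ for all $\alpha\in\mathbb{N}=\mathbb{Z}_{\ge 0}$. In particular, if $\mathsf{K}_1(G)=\mathsf{K}_1^{*}(G)$ then $\mathsf{K}_1(C_{p^{\alpha}}\oplus G)=\mathsf{K}_1^{*}(C_{p^{\alpha}}\oplus G)$ as well.
   Context: Groups are finite abelian, written additively; $C_m$ is the cyclic group of order $m$; $\exp(G)$ is the exponent of $G$; $\mathbb{N}=\mathbb{Z}_{\ge 0}$; $G^{\bullet}=G\setminus\{0\}$. An indexed sequence over $G$ is an element of the free abelian monoid (written multiplicatively, identity $1$) on $G^{\bullet}\times\mathbb{N}$; all indexed sequences are assumed squarefree, i.e. every pair $(g,n)$ occurs with multiplicity at most one, so an indexed sequence is a finite set of labelled nonzero elements of $G$ (the same $g$ may occur with several labels). For an indexed sequence $S$, $\overline{v}_g(S)$ is the number of terms of $S$ with first coordinate $g$, and $\overline{\sigma}(S)=\sum_{g\in G^\bullet}\overline{v}_g(S)\,g\in G$. A subsequence of $S$ is a divisor of $S$ in the monoid. $S$ is zero-sum if $\overline{\sigma}(S)=0$, and irreducible if $S\ne 1$, $S$ is zero-sum, and $S$ has no nontrivial proper zero-sum subsequence. An irreducible factorization of a zero-sum indexed sequence $S$ is a way of writing $S=\prod_{i\le m}S_i$ with all $S_i$ irreducible, up to the order of the factors. $S$ is a unique factorization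 indexed sequence (UFIS) if it is zero-sum and has exactly one irreducible factorization. The cross number of $S$ is $\mathsf{k}(S)=\sum_{g\in G^\bullet}\overline{v}_g(S)/\mathrm{ord}(g)$, and $$\mathsf{K}_1(G)=\max\{\mathsf{k}(S): S \text{ a UFIS over } G\}.$$ Writing $G\cong\bigoplus_{i=1}^{r}C_{p_i^{\alpha_i}}$ as a direct sum of cyclic groups of prime power order ($p_i$ not necessarily distinct), define $$\mathsf{K}_1^{*}(G)=\sum_{i=1}^{r}\frac{p_i^{\alpha_i}-1}{p_i^{\alpha_i}-p_i^{\alpha_i-1}}.$$ A prime $p$ is $2$-wide with respect to a positive integer $n$, written $p\prec_2 n$, if $p\nmid n$ and, with prime factorization $n=q_1^{\alpha_1}\cdots q_r^{\alpha_r}$, $$\frac{p^{2}+2p-2}{p^{2}}\ge\prod_{j=1}^{r}\frac{q_j^{\alpha_j+1}-1}{q_j^{\alpha_j+1}-q_j^{\alpha_j}},$$ the empty product being $1$. *)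

theory Defs
  imports
    Complex_Main
    "HOL-Algebra.Multiplicative_Group"
    "HOL-Algebra.Product_Groups"
    "HOL-Library.Multiset"
    "HOL-Computational_Algebra.Primes"
begin

text \<open>
  Finite abelian groups are the finite instances of \<^locale>\<open>comm_group\<close>, hence written
  multiplicatively: \<open>g [^] n\<close> and \<open>\<one>\<close> play the roles of \<open>n g\<close> and \<open>0\<close>. The direct sum of two
  groups is \<^const>\<open>DirProd\<close>, and the cyclic group of order \<open>m > 0\<close> is \<open>integer_mod_group m\<close>.

  The free abelian monoid on a set \<open>X\<close> is the monoid of finite multisets over \<open>X\<close>: the monoid
  product is multiset sum, the identity is \<open>{#}\<close>, and divisibility is \<open>\<subseteq>#\<close>.
\<close>

definition nonzero_elems :: "('a, 'b) monoid_scheme \<Rightarrow> 'a set" where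
  "nonzero_elems G = carrier G - {\<one>\<^bsub>G\<^esub>}"

definition indexed_seq :: "('a, 'b) monoid_scheme \<Rightarrow> ('a \<times> nat) multiset \<Rightarrow> bool" where
  "indexed_seq G S \<longleftrightarrow>
     set_mset S \<subseteq> nonzero_elems G \<times> UNIV \<and> (\<forall>x. count S x \<le> 1)"

definition val :: "'a \<Rightarrow> ('a \<times> nat) multiset \<Rightarrow> nat" where
  "val g S = size {# x \<in># S. fst x = g #}"

definition seq_sum :: "('a, 'b) monoid_scheme \<Rightarrow> ('a \<times> nat) multiset \<Rightarrow> 'a" where
  "seq_sum G S = finprod G (\<lambda>g. g [^]\<^bsub>G\<^esub> val g S) (nonzero_elems G)"

definition zero_sum :: "('a, 'b) monoid_scheme \<Rightarrow> ('a \<times> nat) multiset \<Rightarrow> bool" where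
  "zero_sum G S \<longleftrightarrow> indexed_seq G S \<and> seq_sum G S = \<one>\<^bsub>G\<^esub>"

definition irreducible_seq :: "('a, 'b) monoid_scheme \<Rightarrow> ('a \<times> nat) multiset \<Rightarrow> bool" where
  "irreducible_seq G S \<longleftrightarrow>
     S \<noteq> {#} \<and> zero_sum G S \<and> \<not> (\<exists>T. T \<subset># S \<and> T \<noteq> {#} \<and> zero_sum G T)"

definition irreducible_factorization ::
    "('a, 'b) monoid_scheme \<Rightarrow> ('a \<times> nat) multiset \<Rightarrow> ('a \<times> nat) multiset multiset \<Rightarrow> bool" where
  "irreducible_factorization G S F \<longleftrightarrow>
     (\<forall>T \<in># F. irreducible_seq G T) \<and> \<Sum>\<^sub># F = S"

definition UFIS :: "('a, 'b) monoid_scheme \<Rightarrow> ('a \<times> nat) multiset \<Rightarrow> bool" where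
  "UFIS G S \<longleftrightarrow> zero_sum G S \<and> (\<exists>!F. irreducible_factorization G S F)"

definition cross_number :: "('a, 'b) monoid_scheme \<Rightarrow> ('a \<times> nat) multiset \<Rightarrow> real" where
  "cross_number G S = (\<Sum>g \<in> nonzero_elems G. real (val g S) / real (group.ord G g))"

text \<open>
  For a finite abelian group the length of a UFIS is bounded in terms of the group, so the set of
  cross numbers below is finite (there are infinitely many UFIS only because of the labels); it is
  nonempty because the empty sequence is a UFIS.
\<close>

definition K1 :: "('a, 'b) monoid_scheme \<Rightarrow> real" where
  "K1 G = Max {cross_number G S | S. UFIS G S}"

text \<open>
  \<open>G\<close> is isomorphic to the direct sum of the cyclic groups of orders \<open>p i ^ \<alpha> i\<close>, \<open>i < r\<close>; the
  direct sum of a finite family is \<^const>\<open>product_group\<close>.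
\<close>

definition prime_power_decomposition ::
    "('a, 'b) monoid_scheme \<Rightarrow> nat \<Rightarrow> (nat \<Rightarrow> nat) \<Rightarrow> (nat \<Rightarrow> nat) \<Rightarrow> bool" where
  "prime_power_decomposition G r p \<alpha> \<longleftrightarrow>
     (\<forall>i<r. prime (p i) \<and> \<alpha> i \<ge> 1) \<and>
     G \<cong> product_group {..<r} (\<lambda>i. integer_mod_group (p i ^ \<alpha> i))"

text \<open>
  The description determines a unique value because every finite abelian group has such a
  decomposition and the orders of its summands are unique up to permutation.
\<close>

definition K1_star :: "('a, 'b) monoid_scheme \<Rightarrow> real" where
  "K1_star G =
     (THE x. \<exists>r p \<alpha>. prime_power_decomposition G r p \<alpha> \<and>
        x = (\<Sum>i<r. (real (p i) ^ \<alpha> i - 1) / (real (p i) ^ \<alpha> i - real (p i) ^ (\<alpha> i - 1))))"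

definition group_exponent :: "('a, 'b) monoid_scheme \<Rightarrow> nat" where
  "group_exponent G = Lcm (group.ord G ` carrier G)"

definition two_wide :: "nat \<Rightarrow> nat \<Rightarrow> bool" (infix \<open>\<prec>\<^sub>2\<close> 50) where
  "p \<prec>\<^sub>2 n \<longleftrightarrow>
     prime p \<and> n > 0 \<and> \<not> p dvd n \<and>
     (real p ^ 2 + 2 * real p - 2) / real p ^ 2 \<ge>
       (\<Prod>q \<in> prime_factors n.
          (real q ^ (multiplicity q n + 1) - 1) /
          (real q ^ (multiplicity q n + 1) - real q ^ multiplicity q n))"

end

theory Submission
  imports Defs
begin

text \<open>
  Additive language is used in this overview: \<open>C\<close> is the cyclic group of order \<open>p ^ \<alpha>\<close>, a term of
  order \<open>m\<close> has weight \<open>1 / m\<close>, and \<open>n\<close> is the exponent of \<open>G\<close>.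

  A zero-sum sequence has a unique factorization if and only if its zero-sum subsequences are closed
  under intersection, the factors being the atoms of the resulting Boolean algebra. This closure
  property passes to subsequences, survives replacing a block of terms by its nonzero sum
  (\<open>uf_family_merge\<close>), and survives suitable quotients (\<open>uf_family_hom_image\<close>). A sequence that has it
  becomes a UFIS by adding minus its sum, so \<open>K1\<close> bounds the weight of all sequences with the
  property (\<open>family_cross_le_K1\<close>).

  The heart of the proof is the inequality \<open>k(S) \<le> 1 + 1/p + \<dots> + 1/p ^ (\<alpha> - 1) + K1 G\<close> for such
  sequences over \<open>C \<oplus> G\<close> (\<open>cross_upper_bound\<close>), by induction on \<open>\<alpha>\<close> and the number of terms. A block
  of at least two terms with nonzero sum may be replaced by its sum whenever this does not lower the
  weight. If no block can be replaced, at most \<open>p\<close> terms have any given order divisible by \<open>p\<close>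
  (\<open>order_class_card_le_prime\<close>). Two cases remain.

  If there are at least \<open>p - 1\<close> terms of order \<open>p\<close>, their subset sums fill the subgroup of order \<open>p\<close>,
  and the other terms can be considered modulo that subgroup. This reduces \<open>\<alpha>\<close> to \<open>\<alpha> - 1\<close>, while the
  removed terms weigh at most 1 and the weights of terms that keep an order divisible by \<open>p\<close> are at
  most \<open>1 / p\<close> times the weights of their images (\<open>cross_bound_via_quotient\<close>).

  If there are at most \<open>p - 2\<close> terms of order \<open>p\<close>, the terms of order prime to \<open>p\<close> weigh at
  most \<open>K1 G\<close>, and it suffices to count the others: allowing \<open>p\<close> terms of each order
  \<open>p ^ l * d\<close> with \<open>1 \<le> l \<le> \<alpha>\<close> and \<open>d\<close> dividing \<open>n\<close>, the orders with \<open>d > 1\<close> contribute at most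
  \<open>1 + 1/p + \<dots> = p / (p - 1)\<close> times the sum of \<open>1 / d\<close> over the divisors \<open>d > 1\<close> of \<open>n\<close>. As \<open>p\<close> is
  2-wide, that sum is at most \<open>2 * (p - 1) / p ^ 2\<close>, so the contribution is at most \<open>2 / p\<close>, exactly the
  weight of the two missing terms of order \<open>p\<close> (\<open>cross_bound_by_counting\<close>).

  Lower bounds come from juxtaposing sequences over the two summands, and over \<open>C\<close> from one explicit
  irreducible sequence of \<open>p\<close> terms for each order \<open>p ^ l\<close>. The upper bound for trivial \<open>G\<close> then gives
  the value of \<open>K1 C\<close>, which equals the summand of \<open>K1_star\<close> for \<open>C\<close>. The second claim needs that
  \<open>K1_star\<close> is additive, hence that decompositions into cyclic groups of prime power order exist
  (\<open>exists_prime_power_decomposition\<close>) and that all of them give the same value (\<open>K1_star_eq\<close>).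
\<close>

section \<open>Sequences with uniquely determined factors as families\<close>

locale finite_comm_group = comm_group G for G (structure) +
  assumes finite_carrier: "finite (carrier G)"

text \<open>
  The labelled terms of a sequence are modelled by an index set \<open>I\<close> and the values \<open>v i\<close>. Such a
  family is called uf here when the intersection of two product-one index sets has product one. No
  condition is put on the product over all of \<open>I\<close>: subsequences of a UFIS are then uf families, and
  every uf family becomes a UFIS by adding the inverse of its total product as one more term. This
  makes the notion stable under all the operations used below.
\<close>

definition uf_family :: "('a, 'b) monoid_scheme \<Rightarrow> 'i set \<Rightarrow> ('i \<Rightarrow> 'a) \<Rightarrow> bool" where
  "uf_family H I v \<longleftrightarrow> finite I \<and> v \<in> I \<rightarrow> nonzero_elems H \<and>
     (\<forall>S T. S \<subseteq> I \<longrightarrow> T \<subseteq> I \<longrightarrow> finprod H v S = \<one>\<^bsub>H\<^esub> \<longrightarrow> finprod H v T = \<one>\<^bsub>H\<^esub>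
        \<longrightarrow> finprod H v (S \<inter> T) = \<one>\<^bsub>H\<^esub>)"

definition family_cross :: "('a, 'b) monoid_scheme \<Rightarrow> 'i set \<Rightarrow> ('i \<Rightarrow> 'a) \<Rightarrow> real" where
  "family_cross H I v = (\<Sum>i\<in>I. 1 / real (group.ord H (v i)))"

lemma uf_familyD:
  assumes "uf_family H I v"
  shows "finite I" "v \<in> I \<rightarrow> carrier H" "\<And>i. i \<in> I \<Longrightarrow> v i \<in> carrier H"
    "\<And>i. i \<in> I \<Longrightarrow> v i \<noteq> \<one>\<^bsub>H\<^esub>"
    "\<And>S T. \<lbrakk>S \<subseteq> I; T \<subseteq> I; finprod H v S = \<one>\<^bsub>H\<^esub>; finprod H v T = \<one>\<^bsub>H\<^esub>\<rbrakk>
       \<Longrightarrow> finprod H v (S \<inter> T) = \<one>\<^bsub>H\<^esub>"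
  using assms by (auto simp: uf_family_def nonzero_elems_def Pi_def)

lemma uf_family_subset: "uf_family H I v \<Longrightarrow> J \<subseteq> I \<Longrightarrow> uf_family H J v"
  unfolding uf_family_def by (auto intro: finite_subset dest: order_trans)

lemma (in comm_group) finprod_Diff_eq_one:
  assumes "finite A" "v \<in> A \<rightarrow> carrier G" "B \<subseteq> A"
    "finprod G v A = \<one>" "finprod G v B = \<one>"
  shows "finprod G v (A - B) = \<one>"
proof -
  have "finprod G v (B \<union> (A - B)) = finprod G v B \<otimes> finprod G v (A - B)"
    using assms by (intro finprod_Un_disjoint) (auto intro: finite_subset)
  moreover have "B \<union> (A - B) = A" using assms by auto
  ultimately show ?thesis using assms by (simp add: Pi_def)
qed

lemma (in comm_group) finprod_Un_eq_one:
  assumes "finite A" "finite B" "v \<in> A \<rightarrow> carrier G" "v \<in> B \<rightarrow> carrier G" "A \<inter> B = {}"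
    "finprod G v A = \<one>" "finprod G v B = \<one>"
  shows "finprod G v (A \<union> B) = \<one>"
  using assms by (simp add: finprod_Un_disjoint)

lemma (in comm_group) finprod_group_by_value:
  assumes "finite A" "finite C" "C \<subseteq> carrier G" "v ` A \<subseteq> C"
  shows "finprod G (\<lambda>g. g [^] card {x \<in> A. v x = g}) C = finprod G v A"
proof -
  have "finprod G v (\<Union>g\<in>C. {x \<in> A. v x = g}) = finprod G (\<lambda>g. finprod G v {x \<in> A. v x = g}) C"
    using assms by (intro finprod_UN_disjoint) (auto simp: pairwise_def disjnt_def)
  moreover have "(\<Union>g\<in>C. {x \<in> A. v x = g}) = A" using assms by auto
  moreover have "finprod G (\<lambda>g. finprod G v {x \<in> A. v x = g}) C
      = finprod G (\<lambda>g. g [^] card {x \<in> A. v x = g}) C"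
  proof (rule finprod_cong')
    fix g assume "g \<in> C"
    then have g: "g \<in> carrier G" using assms by auto
    have "finprod G v {x \<in> A. v x = g} = finprod G (\<lambda>_. g) {x \<in> A. v x = g}"
      using g by (intro finprod_cong') auto
    then show "finprod G v {x \<in> A. v x = g} = g [^] card {x \<in> A. v x = g}"
      using finprod_const[OF g] by simp
  qed (use assms in auto)
  ultimately show ?thesis by simp
qed

lemma eq_mset_set_if_count_le_one:
  assumes "\<And>x. count S x \<le> 1"
  shows "S = mset_set (set_mset S)"
proof (rule multiset_eqI)
  fix x
  show "count S x = count (mset_set (set_mset S)) x"
    using assms[of x] count_greater_zero_iff[of S x] le_antisym[of "count S x" 1]
    by (cases "x \<in># S") (auto simp: count_mset_set' not_in_iff)
qed

context finite_comm_group
begin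

lemma val_mset_set: "finite A \<Longrightarrow> val g (mset_set A) = card {x \<in> A. fst x = g}"
  unfolding val_def by (simp add: filter_mset_mset_set)

lemma indexed_seq_mset_set:
  "finite A \<Longrightarrow> indexed_seq G (mset_set A) \<longleftrightarrow> fst ` A \<subseteq> nonzero_elems G"
  unfolding indexed_seq_def by (auto simp: count_mset_set')

lemma indexed_seq_eq_mset_set: "indexed_seq G S \<Longrightarrow> S = mset_set (set_mset S)"
  unfolding indexed_seq_def by (blast intro: eq_mset_set_if_count_le_one)

lemma zero_sum_mset_set:
  assumes "finite A"
  shows "zero_sum G (mset_set A) \<longleftrightarrow> fst ` A \<subseteq> nonzero_elems G \<and> finprod G fst A = \<one>"
proof (cases "fst ` A \<subseteq> nonzero_elems G")
  case True
  have "seq_sum G (mset_set A) = finprod G fst A"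
    unfolding seq_sum_def using assms True finite_carrier
    by (subst finprod_group_by_value[symmetric, of A "nonzero_elems G" fst])
       (auto simp: val_mset_set nonzero_elems_def)
  then show ?thesis using True assms by (simp add: zero_sum_def indexed_seq_mset_set)
qed (use assms in \<open>simp add: zero_sum_def indexed_seq_mset_set\<close>)

lemma cross_number_mset_set:
  assumes "finite A" "fst ` A \<subseteq> nonzero_elems G"
  shows "cross_number G (mset_set A) = family_cross G A fst"
proof -
  have "(\<Sum>g\<in>nonzero_elems G. \<Sum>x\<in>{x\<in>A. fst x = g}. 1 / real (ord (fst x)))
     = (\<Sum>x\<in>A. 1 / real (ord (fst x)))"
    using assms finite_carrier by (intro sum.group) (auto simp: nonzero_elems_def)
  then show ?thesis
    unfolding cross_number_def family_cross_def using assms by (simp add: val_mset_set)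
qed

lemma subseteq_mset_setE:
  assumes "T \<subseteq># mset_set A" "finite A"
  shows "T = mset_set (set_mset T)" "set_mset T \<subseteq> A"
proof -
  show "set_mset T \<subseteq> A" using assms set_mset_mono by fastforce
  have "count T x \<le> 1" for x
    using mset_subset_eq_count[OF assms(1), of x] by (auto simp: count_mset_set' split: if_splits)
  then show "T = mset_set (set_mset T)" by (rule eq_mset_set_if_count_le_one)
qed

lemma exists_irreducible_factorization:
  assumes "zero_sum G S"
  shows "\<exists>F. irreducible_factorization G S F"
  using assms
proof (induction "size S" arbitrary: S rule: less_induct)
  case less
  show ?case
  proof (cases "S = {#} \<or> irreducible_seq G S")
    case True
    then have "irreducible_factorization G S (if S = {#} then {#} else {#S#})"
      by (auto simp: irreducible_factorization_def)
    then show ?thesis by blast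
  next
    case False
    then obtain T where T: "T \<subset># S" "T \<noteq> {#}" "zero_sum G T"
      using less.prems by (auto simp: irreducible_seq_def)
    have S: "S = mset_set (set_mset S)"
      using less.prems indexed_seq_eq_mset_set zero_sum_def by blast
    have T': "T = mset_set (set_mset T)" "set_mset T \<subseteq> set_mset S"
      using subseteq_mset_setE[of T "set_mset S"] T S by auto
    have D: "S - T = mset_set (set_mset S - set_mset T)"
      using S T' by (metis finite_set_mset mset_set_Diff)
    have zS: "fst ` set_mset S \<subseteq> nonzero_elems G" "finprod G fst (set_mset S) = \<one>"
      using less.prems S zero_sum_mset_set[of "set_mset S"] by auto
    have zT: "finprod G fst (set_mset T) = \<one>"
      using T(3) T'(1) zero_sum_mset_set[of "set_mset T"] by auto
    have "zero_sum G (S - T)"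
      unfolding D using zS zT T'
      by (subst zero_sum_mset_set) (auto intro!: finprod_Diff_eq_one simp: nonzero_elems_def)
    moreover have "size (S - T) < size S" "size T < size S"
      using T mset_subset_size[OF T(1)] nonempty_has_size[of T]
      by (auto simp: size_Diff_submset subset_mset.less_imp_le)
    ultimately obtain F1 F2 where
      "irreducible_factorization G T F1" "irreducible_factorization G (S - T) F2"
      using less.hyps T by meson
    then have "irreducible_factorization G S (F1 + F2)"
      using T by (auto simp: irreducible_factorization_def subset_mset.less_imp_le)
    then show ?thesis by blast
  qed
qed

lemma irreducible_mset_set:
  assumes "finite A"
  shows "irreducible_seq G (mset_set A) \<longleftrightarrow> A \<noteq> {} \<and> fst ` A \<subseteq> nonzero_elems G \<and> finprod G fst A = \<one>
    \<and> (\<forall>B. B \<subset> A \<longrightarrow> B \<noteq> {} \<longrightarrow> finprod G fst B \<noteq> \<one>)" (is "?L \<longleftrightarrow> ?R")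
proof
  assume ?L
  then have *: "mset_set A \<noteq> {#}" "zero_sum G (mset_set A)"
    "\<And>T. T \<subset># mset_set A \<Longrightarrow> T \<noteq> {#} \<Longrightarrow> \<not> zero_sum G T"
    by (auto simp: irreducible_seq_def)
  have z: "fst ` A \<subseteq> nonzero_elems G" "finprod G fst A = \<one>"
    using *(2) zero_sum_mset_set[OF assms] by auto
  have "finprod G fst B \<noteq> \<one>" if "B \<subset> A" "B \<noteq> {}" for B
  proof -
    have B: "finite B" using that assms finite_subset by blast
    have "mset_set B \<subset># mset_set A"
      using that B assms by (simp add: subset_mset.less_le subset_imp_msubset_mset_set psubset_eq mset_set_eq_iff)
    then have "\<not> zero_sum G (mset_set B)" using *(3) that B by (simp add: mset_set_empty_iff)
    then show ?thesis using zero_sum_mset_set[OF B] z that by auto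
  qed
  then show ?R using z * assms by (auto simp: mset_set_empty_iff)
next
  assume R: ?R
  have "\<not> zero_sum G T" if T: "T \<subset># mset_set A" "T \<noteq> {#}" for T
  proof -
    have T': "T = mset_set (set_mset T)" "set_mset T \<subseteq> A"
      using subseteq_mset_setE[of T A] T assms by auto
    then have "set_mset T \<noteq> A" using T by auto
    then have "finprod G fst (set_mset T) \<noteq> \<one>" using R T T' by auto
    then show ?thesis by (subst T'(1)) (simp add: zero_sum_mset_set)
  qed
  then show ?L using R assms by (auto simp: irreducible_seq_def zero_sum_mset_set mset_set_empty_iff)
qed

text \<open>
  If a zero-sum set is not irreducible, it is the disjoint union of two smaller zero-sum sets, and
  one of the two contains \<open>x\<close>.
\<close>

lemma exists_irreducible_containing:
  assumes "finite A" "fst ` A \<subseteq> nonzero_elems G" "finprod G fst A = \<one>" "x \<in> A"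
  shows "\<exists>M. M \<subseteq> A \<and> x \<in> M \<and> irreducible_seq G (mset_set M)"
  using assms
proof (induction "card A" arbitrary: A rule: less_induct)
  case less
  show ?case
  proof (cases "irreducible_seq G (mset_set A)")
    case False
    then obtain B where B: "B \<subset> A" "B \<noteq> {}" "finprod G fst B = \<one>"
      using less.prems by (auto simp: irreducible_mset_set)
    define C where "C = (if x \<in> B then B else A - B)"
    have "C \<subset> A" "x \<in> C" using B less.prems by (auto simp: C_def)
    moreover have "finprod G fst (A - B) = \<one>"
      using B less.prems by (intro finprod_Diff_eq_one) (auto simp: nonzero_elems_def)
    then have "finprod G fst C = \<one>" using B by (simp add: C_def)
    moreover have "finite C" "card C < card A"
      using \<open>C \<subset> A\<close> less.prems psubset_card_mono finite_subset by blast+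
    moreover have "fst ` C \<subseteq> nonzero_elems G" using \<open>C \<subset> A\<close> less.prems(2) by blast
    ultimately obtain M where "M \<subseteq> C" "x \<in> M" "irreducible_seq G (mset_set M)"
      using less.hyps[of C] by auto
    then show ?thesis using \<open>C \<subset> A\<close> by blast
  qed (use less in blast)
qed

text \<open>
  Every irreducible subsequence of a zero-sum sequence is a factor of some factorization, because
  its complement factors too. When the factorization is unique, two irreducible subsequences are
  therefore factors of the same factorization, hence equal or disjoint. A zero-sum subsequence is
  then a union of these atoms, and such unions are closed under intersection.
\<close>

lemma uf_family_if_UFIS:
  assumes "UFIS G S"
  shows "S = mset_set (set_mset S)" "uf_family G (set_mset S) fst"
proof -
  define A where "A = set_mset S"
  show S: "S = mset_set (set_mset S)"
    using assms UFIS_def zero_sum_def indexed_seq_eq_mset_set by blast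
  then have SA: "S = mset_set A" and fin: "finite A" by (auto simp: A_def)
  have z: "fst ` A \<subseteq> nonzero_elems G" "finprod G fst A = \<one>"
    using assms SA fin by (auto simp: UFIS_def zero_sum_mset_set)
  then have cl: "fst \<in> B \<rightarrow> carrier G" if "B \<subseteq> A" for B using that by (auto simp: nonzero_elems_def)
  have disj: "M \<inter> N = {}"
    if M: "M \<subseteq> A" "irreducible_seq G (mset_set M)" and N: "N \<subseteq> A" "irreducible_seq G (mset_set N)" "M \<noteq> N"
    for M N
  proof -
    have ext: "\<exists>F. irreducible_factorization G S F \<and> mset_set B \<in># F"
      if B: "B \<subseteq> A" "irreducible_seq G (mset_set B)" for B
    proof -
      have fB: "finite B" using B fin finite_subset by blast
      have "finprod G fst (A - B) = \<one>"
        using B fB fin z cl by (intro finprod_Diff_eq_one) (auto simp: irreducible_mset_set)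
      then have "zero_sum G (mset_set (A - B))" using fin z by (auto simp: zero_sum_mset_set)
      then obtain F where F: "irreducible_factorization G (mset_set (A - B)) F"
        using exists_irreducible_factorization by blast
      have "mset_set B + mset_set (A - B) = mset_set A"
        using B(1) fin fB by (simp add: mset_set_Diff subset_imp_msubset_mset_set)
      then have "irreducible_factorization G S (add_mset (mset_set B) F)"
        using F B by (simp add: irreducible_factorization_def SA)
      then show ?thesis by force
    qed
    obtain F where F: "irreducible_factorization G S F" "mset_set M \<in># F" "mset_set N \<in># F"
      using ext[OF M] ext[OF N(1,2)] assms unfolding UFIS_def by metis
    have "finite M" "finite N" using M N fin finite_subset by blast+
    then have "mset_set M \<noteq> mset_set N" using N(3) by (simp add: mset_set_eq_iff)
    then obtain F' where "F = add_mset (mset_set M) (add_mset (mset_set N) F')"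
      using F by (metis insert_DiffM insert_noteq_member multi_member_split)
    then have "(mset_set M + mset_set N) + \<Sum>\<^sub># F' = mset_set A"
      using F SA by (simp add: irreducible_factorization_def add.assoc)
    then have "mset_set M + mset_set N \<subseteq># mset_set A"
      by (metis mset_subset_eq_add_left)
    then have "count (mset_set M + mset_set N) x \<le> count (mset_set A) x" for x
      by (rule mset_subset_eq_count)
    moreover have "count (mset_set A) x \<le> 1" for x by (simp add: count_mset_set')
    ultimately have le: "count (mset_set M + mset_set N) x \<le> 1" for x using order_trans by blast
    have False if "x \<in> M" "x \<in> N" for x
      using le[of x] that \<open>finite M\<close> \<open>finite N\<close> by (simp add: count_mset_set')
    then show ?thesis by blast
  qed
  have "finprod G fst (T \<inter> U) = \<one>"
    if "T \<subseteq> A" "U \<subseteq> A" "finprod G fst T = \<one>" "finprod G fst U = \<one>" for T U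
    using that
  proof (induction "card T" arbitrary: T U rule: less_induct)
    case less
    have fT: "finite T" "finite U" using less.prems fin finite_subset by blast+
    show ?case
    proof (cases "T = {}")
      case False
      then obtain x where "x \<in> T" by blast
      then obtain M where M: "M \<subseteq> T" "x \<in> M" "irreducible_seq G (mset_set M)"
        using exists_irreducible_containing[of T x] fT less.prems z by blast
      have fM: "finite M" using M fT finite_subset by blast
      have pM: "finprod G fst M = \<one>" using M fM by (auto simp: irreducible_mset_set)
      have c: "card (T - M) < card T" using M fT by (intro psubset_card_mono) auto
      have pT: "finprod G fst (T - M) = \<one>"
        using fT cl[OF less.prems(1)] M(1) less.prems pM by (intro finprod_Diff_eq_one) auto
      have IH: "finprod G fst ((T - M) \<inter> U) = \<one>"
        using less.hyps[OF c _ less.prems(2) pT less.prems(4)] less.prems(1) by auto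
      show ?thesis
      proof (cases "M \<subseteq> U")
        case True
        have "finprod G fst (M \<union> ((T - M) \<inter> U)) = \<one>"
          using fM fT pM IH cl less.prems M by (intro finprod_Un_eq_one) auto
        moreover have "M \<union> ((T - M) \<inter> U) = T \<inter> U" using True M by auto
        ultimately show ?thesis by simp
      next
        case False
        have "M \<inter> U = {}"
        proof (rule ccontr)
          assume "M \<inter> U \<noteq> {}"
          then obtain y where y: "y \<in> M" "y \<in> U" by blast
          then obtain N where N: "N \<subseteq> U" "y \<in> N" "irreducible_seq G (mset_set N)"
            using exists_irreducible_containing[of U y] fT less.prems z by blast
          then have "M = N" using disj[of M N] M y less.prems by blast
          then show False using False N by blast
        qed
        then have "(T - M) \<inter> U = T \<inter> U" by auto
        then show ?thesis using IH by simp
      qed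
    qed simp
  qed
  then show "uf_family G (set_mset S) fst"
    unfolding uf_family_def A_def[symmetric] using fin z by auto
qed

text \<open>
  Factors from two factorizations that share a term meet in a zero-sum set, which by irreducibility
  is all of both factors.
\<close>

lemma UFIS_if_uf_family:
  assumes uf: "uf_family G A fst" and one: "finprod G fst A = \<one>"
  shows "UFIS G (mset_set A)"
proof -
  note [simp] = uf_familyD(1)[OF uf]
  have z: "zero_sum G (mset_set A)"
    using one uf by (subst zero_sum_mset_set) (auto simp: uf_family_def)
  have sub: "set_mset F \<subseteq> set_mset F'"
    if F: "irreducible_factorization G (mset_set A) F" and F': "irreducible_factorization G (mset_set A) F'"
    for F F'
  proof
    fix M assume M: "M \<in># F"
    have part: "N = mset_set (set_mset N) \<and> set_mset N \<subseteq> A \<and> irreducible_seq G (mset_set (set_mset N))"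
      if "N \<in># K" "irreducible_factorization G (mset_set A) K" for N K
    proof -
      have "N \<subseteq># mset_set A"
        using that unfolding irreducible_factorization_def
        by (metis mset_subset_eq_add_left multi_member_split sum_mset.add_mset)
      then have "N = mset_set (set_mset N) \<and> set_mset N \<subseteq> A"
        using subseteq_mset_setE[of N A] by simp
      then show ?thesis using that by (auto simp: irreducible_factorization_def)
    qed
    obtain x where x: "x \<in># M" using part[OF M F] by (auto simp: irreducible_mset_set)
    then have "x \<in> A" using part[OF M F] by blast
    then have "x \<in># \<Sum>\<^sub># F'" using F' by (simp add: irreducible_factorization_def)
    then obtain M' where M': "M' \<in># F'" "x \<in># M'" by auto
    note p = part[OF M F] part[OF M'(1) F']
    have "finprod G fst (set_mset M) = \<one>" "finprod G fst (set_mset M') = \<one>"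
      using p by (auto simp: irreducible_mset_set)
    then have "finprod G fst (set_mset M \<inter> set_mset M') = \<one>"
      using uf_familyD(5)[OF uf] p by blast
    moreover have "set_mset M \<inter> set_mset M' \<noteq> {}" using x M' by auto
    moreover have "\<forall>B. B \<subset> set_mset N \<longrightarrow> B \<noteq> {} \<longrightarrow> finprod G fst B \<noteq> \<one>"
      if "irreducible_seq G (mset_set (set_mset N))" for N
      using that irreducible_mset_set[of "set_mset N"] by blast
    ultimately have "set_mset M = set_mset M'"
      using p(1,2) by blast
    then have "M = M'" using p(1,2) by (metis (lifting))
    then show "M \<in># F'" using M' by simp
  qed
  have dist: "F = mset_set (set_mset F)" if F: "irreducible_factorization G (mset_set A) F" for F
  proof (rule eq_mset_set_if_count_le_one)
    fix M
    show "count F M \<le> 1"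
    proof (rule ccontr)
      assume "\<not> count F M \<le> 1"
      then have "0 < count F M" "0 < count (F - {#M#}) M" unfolding count_diff by (linarith, simp)
      then have M: "M \<in># F" and M2: "M \<in># F - {#M#}" by (simp_all only: count_greater_zero_iff)
      obtain F1 where F1: "F = add_mset M F1" using M by (meson multi_member_split)
      with M2 have "M \<in># F1" by simp
      then obtain F' where "F1 = add_mset M F'" by (meson multi_member_split)
      with F1 have "(M + M) + \<Sum>\<^sub># F' = mset_set A"
        using F by (simp add: irreducible_factorization_def add.assoc)
      then have s: "M + M \<subseteq># mset_set A" by (metis mset_subset_eq_add_left)
      have "M \<noteq> {#}" using F M by (auto simp: irreducible_factorization_def irreducible_seq_def)
      then obtain x where "x \<in># M" by blast
      then have "0 < count M x" by (simp only: count_greater_zero_iff)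
      moreover have "count (M + M) x \<le> count (mset_set A) x" using s by (rule mset_subset_eq_count)
      moreover have "count (mset_set A) x \<le> 1" by (simp add: count_mset_set')
      ultimately show False unfolding count_union by linarith
    qed
  qed
  have "F = F'" if "irreducible_factorization G (mset_set A) F" "irreducible_factorization G (mset_set A) F'" for F F'
    using sub[OF that] sub[OF that(2,1)] dist[OF that(1)] dist[OF that(2)] by (metis subset_antisym)
  then show ?thesis unfolding UFIS_def using z exists_irreducible_factorization by blast
qed

text \<open>
  With \<open>ord g + 1\<close> copies of \<open>g\<close>, two different sets of \<open>ord g\<close> copies would meet in a product-one
  set of \<open>ord g - 1\<close> copies. The bound makes the set of cross numbers finite, so that the maximum in
  the definition of \<^const>\<open>K1\<close> is attained.
\<close>

lemma uf_family_fiber_card: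
  assumes uf: "uf_family G I v" and g: "g \<in> carrier G"
  shows "card {i \<in> I. v i = g} \<le> ord g"
proof (rule ccontr)
  assume "\<not> card {i \<in> I. v i = g} \<le> ord g"
  then have "Suc (ord g) \<le> card {i \<in> I. v i = g}" by simp
  then obtain W where W: "W \<subseteq> {i \<in> I. v i = g}" "card W = Suc (ord g)" "finite W"
    by (rule obtain_subset_with_card_n)
  have o: "ord g > 0" using ord_ge_1 finite_carrier g by force
  have pr: "finprod G v B = g [^] card B" if "B \<subseteq> W" for B
  proof -
    have "finprod G v B = finprod G (\<lambda>_. g) B" using that W g by (intro finprod_cong') auto
    then show ?thesis using finprod_const[OF g] by simp
  qed
  obtain i where i: "i \<in> W" using W(2) by fastforce
  obtain j where j: "j \<in> W - {i}" using W(2,3) i o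
    by (metis card_Diff_singleton card_gt_0_iff diff_Suc_1 equals0I)
  have one: "finprod G v (W - {k}) = \<one>" if "k \<in> W" for k
    using that W g by (subst pr) auto
  have "finprod G v ((W - {i}) \<inter> (W - {j})) = \<one>"
    using W i j by (intro uf_familyD(5)[OF uf] one) auto
  moreover have "(W - {i}) \<inter> (W - {j}) = W - {i,j}" by auto
  moreover have "card (W - {i,j}) = ord g - 1" using W(2,3) i j by (subst card_Diff_subset) auto
  ultimately have "g [^] (ord g - 1) = \<one>" using pr[of "W - {i,j}"] by auto
  then have "ord g dvd ord g - 1" using g by (simp add: pow_eq_id)
  then have "ord g = 1" using o dvd_imp_le[of "ord g" "ord g - 1"] by force
  then have "g = \<one>" using g ord_eq_1 by blast
  moreover have "g \<noteq> \<one>" using uf_familyD(4)[OF uf, of i] W i by auto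
  ultimately show False by simp
qed

lemma finite_UFIS_cross_numbers: "finite {cross_number G S | S. UFIS G S}"
proof -
  let ?N = "nonzero_elems G"
  have fN: "finite ?N" using finite_carrier by (simp add: nonzero_elems_def)
  have "{cross_number G S | S. UFIS G S} \<subseteq>
     (\<lambda>f. \<Sum>g\<in>?N. real (f g) / real (ord g)) ` (PiE ?N (\<lambda>g. {..ord g}))"
  proof clarify
    fix S assume "UFIS G S"
    note u = uf_family_if_UFIS[OF this]
    have v: "val g S \<le> ord g" if "g \<in> ?N" for g
    proof -
      have "val g S = card {x \<in> set_mset S. fst x = g}" 
        by (subst u(1)) (simp add: val_mset_set)
      then show ?thesis using uf_family_fiber_card[OF u(2)] that by (simp add: nonzero_elems_def)
    qed
    have "cross_number G S = (\<Sum>g\<in>?N. real (restrict (\<lambda>g. val g S) ?N g) / real (ord g))"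
      unfolding cross_number_def by (intro sum.cong) auto
    moreover have "restrict (\<lambda>g. val g S) ?N \<in> PiE ?N (\<lambda>g. {..ord g})" using v by auto
    ultimately show "cross_number G S \<in> (\<lambda>f. \<Sum>g\<in>?N. real (f g) / real (ord g)) ` (PiE ?N (\<lambda>g. {..ord g}))"
      by (rule image_eqI)
  qed
  moreover have "finite (PiE ?N (\<lambda>g. {..ord g}))" using fN by (intro finite_PiE) auto
  ultimately show ?thesis by (meson finite_imageI finite_subset)
qed

end

section \<open>Operations on families\<close>

text \<open>
  Both relabelling the terms and merging a block of terms into one are instances: \<open>\<psi>\<close> replaces an
  index set of the new family by the index set of the old one that it stands for.
\<close>

lemma uf_family_pullback:
  assumes uf: "uf_family H I v" and J: "finite J" "w \<in> J \<rightarrow> nonzero_elems H"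
    and sub: "\<And>S. S \<subseteq> J \<Longrightarrow> \<psi> S \<subseteq> I"
    and prod: "\<And>S. S \<subseteq> J \<Longrightarrow> finprod H w S = finprod H v (\<psi> S)"
    and Int: "\<And>S T. S \<subseteq> J \<Longrightarrow> T \<subseteq> J \<Longrightarrow> \<psi> (S \<inter> T) = \<psi> S \<inter> \<psi> T"
  shows "uf_family H J w"
proof -
  have "finprod H w (S \<inter> T) = \<one>\<^bsub>H\<^esub>"
    if "S \<subseteq> J" "T \<subseteq> J" "finprod H w S = \<one>\<^bsub>H\<^esub>" "finprod H w T = \<one>\<^bsub>H\<^esub>" for S T
  proof -
    have "finprod H w (S \<inter> T) = finprod H v (\<psi> S \<inter> \<psi> T)"
      using that prod[of "S \<inter> T"] Int[of S T] by (metis le_infI1)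
    then show ?thesis
      using that sub prod uf_familyD(5)[OF uf, of "\<psi> S" "\<psi> T"] by metis
  qed
  then show ?thesis using J unfolding uf_family_def by blast
qed

context comm_group
begin

lemma uf_family_reindex:
  assumes uf: "uf_family G I v" and inj: "inj_on e I" and w: "\<And>i. i \<in> I \<Longrightarrow> w (e i) = v i"
  shows "uf_family G (e ` I) w"
proof (rule uf_family_pullback[OF uf, where \<psi> = "\<lambda>S. {i \<in> I. e i \<in> S}"])
  show "w \<in> e ` I \<rightarrow> nonzero_elems G" using uf w by (auto simp: uf_family_def)
  fix S assume S: "S \<subseteq> e ` I"
  have "finprod G w (e ` {i \<in> I. e i \<in> S}) = finprod G (\<lambda>i. w (e i)) {i \<in> I. e i \<in> S}"
    using uf_familyD(3)[OF uf] w inj by (intro finprod_reindex) (auto intro: inj_on_subset)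
  moreover have "e ` {i \<in> I. e i \<in> S} = S" using S by auto
  moreover have "finprod G (\<lambda>i. w (e i)) {i \<in> I. e i \<in> S} = finprod G v {i \<in> I. e i \<in> S}"
    using uf_familyD(3)[OF uf] w by (intro finprod_cong') auto
  ultimately show "finprod G w S = finprod G v {i \<in> I. e i \<in> S}" by simp
qed (use uf_familyD(1)[OF uf] in auto)

lemma uf_family_merge:
  assumes uf: "uf_family G I v" and T: "T \<subseteq> I" "t \<in> T" "finprod G v T \<noteq> \<one>"
  shows "uf_family G (insert t (I - T)) (v(t := finprod G v T))" (is "uf_family G ?J ?w")
proof (rule uf_family_pullback[OF uf, where \<psi> = "\<lambda>S. if t \<in> S then (S - {t}) \<union> T else S"])
  have fin: "finite I" "finite T" using uf_familyD(1)[OF uf] T finite_subset by auto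
  have cl: "v \<in> S \<rightarrow> carrier G" if "S \<subseteq> I" for S using uf_familyD(3)[OF uf] that by auto
  show "finite ?J" using fin by simp
  show "?w \<in> ?J \<rightarrow> nonzero_elems G"
    using T cl[OF T(1)] uf by (auto simp: uf_family_def nonzero_elems_def)
  fix S assume S: "S \<subseteq> ?J"
  show "(if t \<in> S then (S - {t}) \<union> T else S) \<subseteq> I" using S T by auto
  show "finprod G ?w S = finprod G v (if t \<in> S then (S - {t}) \<union> T else S)"
  proof (cases "t \<in> S")
    case True
    have fS: "finite (S - {t})" using S fin finite_subset[of "S - {t}" I] by auto
    have "finprod G ?w (insert t (S - {t})) = finprod G v T \<otimes> finprod G ?w (S - {t})"
      using fS S T cl by (subst finprod_insert) auto
    also have "finprod G ?w (S - {t}) = finprod G v (S - {t})"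
      using S cl[of "S - {t}"] by (intro finprod_cong') auto
    also have "finprod G v T \<otimes> finprod G v (S - {t}) = finprod G v (T \<union> (S - {t}))"
      using fS fin S T cl[of T] cl[of "S - {t}"] by (intro finprod_Un_disjoint[symmetric]) auto
    finally have "finprod G ?w (insert t (S - {t})) = finprod G v ((S - {t}) \<union> T)"
      by (simp only: Un_commute)
    moreover have "insert t (S - {t}) = S" using True by auto
    ultimately show ?thesis using True by (simp only: if_True)
  next
    case False
    then have "finprod G ?w S = finprod G v S"
      using S cl[of S] by (intro finprod_cong') auto
    then show ?thesis using False by simp
  qed
qed (auto split: if_splits)

lemma uf_family_Un:
  assumes uf: "uf_family G I v" "uf_family G J v" and disj: "I \<inter> J = {}"
    and split: "\<And>T. T \<subseteq> I \<union> J \<Longrightarrow> finprod G v T = \<one> \<Longrightarrow> finprod G v (T \<inter> I) = \<one>"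
  shows "uf_family G (I \<union> J) v"
  unfolding uf_family_def
proof (intro conjI allI impI)
  show "finite (I \<union> J)" using uf uf_familyD(1) by blast
  show "v \<in> I \<union> J \<rightarrow> nonzero_elems G" using uf by (auto simp: uf_family_def)
  have fin: "finite I" "finite J" using uf uf_familyD(1) by blast+
  have cl: "v \<in> S \<rightarrow> carrier G" if "S \<subseteq> I \<union> J" for S
    using uf that unfolding uf_family_def nonzero_elems_def by fast
  fix S T assume *: "S \<subseteq> I \<union> J" "T \<subseteq> I \<union> J" "finprod G v S = \<one>" "finprod G v T = \<one>"
  have J: "finprod G v (A \<inter> J) = \<one>" if A: "A \<subseteq> I \<union> J" "finprod G v A = \<one>" for A
  proof -
    have "finprod G v (A - A \<inter> I) = \<one>"
      using A split[OF A] cl[OF A(1)] fin finite_subset[OF A(1)] by (intro finprod_Diff_eq_one) auto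
    moreover have "A - A \<inter> I = A \<inter> J" using A disj by auto
    ultimately show ?thesis by simp
  qed
  have "finprod G v ((S \<inter> I) \<inter> (T \<inter> I)) = \<one>"
    by (rule uf_familyD(5)[OF uf(1) Int_lower2 Int_lower2 split[OF *(1,3)] split[OF *(2,4)]])
  moreover have "finprod G v ((S \<inter> J) \<inter> (T \<inter> J)) = \<one>"
    by (rule uf_familyD(5)[OF uf(2) Int_lower2 Int_lower2 J[OF *(1,3)] J[OF *(2,4)]])
  moreover have "S \<inter> T = ((S \<inter> I) \<inter> (T \<inter> I)) \<union> ((S \<inter> J) \<inter> (T \<inter> J))" using * by auto
  moreover have "finprod G v (((S \<inter> I) \<inter> (T \<inter> I)) \<union> ((S \<inter> J) \<inter> (T \<inter> J))) = \<one>"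
    using calculation(1,2) fin disj cl[of "(S \<inter> I) \<inter> (T \<inter> I)"] cl[of "(S \<inter> J) \<inter> (T \<inter> J)"]
    by (intro finprod_Un_eq_one) auto
  ultimately show "finprod G v (S \<inter> T) = \<one>" by simp
qed

lemma hom_finprod:
  assumes "comm_group H" "f \<in> hom G H" "v \<in> A \<rightarrow> carrier G"
  shows "f (finprod G v A) = finprod H (\<lambda>i. f (v i)) A"
  using assms(3)
proof (induction A rule: infinite_finite_induct)
  interpret H: comm_group H by fact
  {
    case (infinite A)
    then show ?case using hom_one[OF assms(2) is_group H.is_group] by simp
  next
    case empty
    then show ?case using hom_one[OF assms(2) is_group H.is_group] by simp
  next
    case (insert x A)
    then show ?case
      using hom_mult[OF assms(2), of "v x" "finprod G v A"] hom_in_carrier[OF assms(2)]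
      by (simp add: Pi_iff)
  }
qed

text \<open>
  The principle behind every passage to a quotient: if each subset of the remaining terms that
  becomes product-one under \<open>f\<close> can be completed to a product-one set by discarded terms from the
  kernel, then the images of the remaining terms form a uf family. Intersecting two such completions
  gives a completion of the intersection.
\<close>

lemma uf_family_hom_image:
  assumes uf: "uf_family G I v" and H: "comm_group H" and f: "f \<in> hom G H" and E: "E \<subseteq> I"
    and kernel: "\<And>i. i \<in> E \<Longrightarrow> f (v i) = \<one>\<^bsub>H\<^esub>"
    and cover: "\<And>T. T \<subseteq> I - E \<Longrightarrow> f (finprod G v T) = \<one>\<^bsub>H\<^esub> \<Longrightarrow>
      \<exists>F\<subseteq>E. finprod G v T \<otimes> finprod G v F = \<one>"
    and nz: "\<And>i. i \<in> I - E \<Longrightarrow> f (v i) \<noteq> \<one>\<^bsub>H\<^esub>"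
  shows "uf_family H (I - E) (\<lambda>i. f (v i))"
  unfolding uf_family_def
proof (intro conjI allI impI)
  interpret H: comm_group H by fact
  have fin: "finite I" using uf_familyD(1)[OF uf] .
  have cl: "v \<in> S \<rightarrow> carrier G" if "S \<subseteq> I" for S using uf_familyD(3)[OF uf] that by auto
  show "finite (I - E)" using fin by simp
  show "(\<lambda>i. f (v i)) \<in> I - E \<rightarrow> nonzero_elems H"
    using nz uf_familyD(3)[OF uf] hom_in_carrier[OF f] by (auto simp: nonzero_elems_def)
  have lift: "\<exists>F\<subseteq>E. finprod G v (S \<union> F) = \<one>"
    if S: "S \<subseteq> I - E" "finprod H (\<lambda>i. f (v i)) S = \<one>\<^bsub>H\<^esub>" for S
  proof -
    have "f (finprod G v S) = \<one>\<^bsub>H\<^esub>" using S cl[of S] by (subst hom_finprod[OF H f]) auto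
    then obtain F where F: "F \<subseteq> E" "finprod G v S \<otimes> finprod G v F = \<one>"
      using cover S by blast
    moreover have "finprod G v (S \<union> F) = finprod G v S \<otimes> finprod G v F"
      using S F E fin cl[of S] cl[of F] finite_subset[of S I] finite_subset[of F I]
      by (intro finprod_Un_disjoint) auto
    ultimately show ?thesis by auto
  qed
  fix S T assume *: "S \<subseteq> I - E" "T \<subseteq> I - E" "finprod H (\<lambda>i. f (v i)) S = \<one>\<^bsub>H\<^esub>"
    "finprod H (\<lambda>i. f (v i)) T = \<one>\<^bsub>H\<^esub>"
  obtain F K where FK: "F \<subseteq> E" "K \<subseteq> E" "finprod G v (S \<union> F) = \<one>" "finprod G v (T \<union> K) = \<one>"
    using lift * by meson
  have sub: "S \<inter> T \<subseteq> I" "F \<inter> K \<subseteq> I" using * FK E by auto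
  have "finprod G v ((S \<union> F) \<inter> (T \<union> K)) = \<one>"
    using uf_familyD(5)[OF uf, of "S \<union> F" "T \<union> K"] * FK E by blast
  moreover have "(S \<union> F) \<inter> (T \<union> K) = (S \<inter> T) \<union> (F \<inter> K)" using * FK by auto
  moreover have "finprod G v ((S \<inter> T) \<union> (F \<inter> K)) = finprod G v (S \<inter> T) \<otimes> finprod G v (F \<inter> K)"
    using * FK sub cl finite_subset[OF sub(1) fin] finite_subset[OF sub(2) fin]
    by (intro finprod_Un_disjoint) blast+
  ultimately have e: "finprod G v (S \<inter> T) \<otimes> finprod G v (F \<inter> K) = \<one>" by simp
  have "finprod H (\<lambda>i. f (v i)) (F \<inter> K) = \<one>\<^bsub>H\<^esub>"
    using FK kernel by (intro H.finprod_one_eqI) auto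
  then have "f (finprod G v (F \<inter> K)) = \<one>\<^bsub>H\<^esub>"
    using hom_finprod[OF H f cl[OF sub(2)]] by simp
  moreover have "f (finprod G v (S \<inter> T) \<otimes> finprod G v (F \<inter> K)) = \<one>\<^bsub>H\<^esub>"
    using e hom_one[OF f is_group H.is_group] by simp
  ultimately have "f (finprod G v (S \<inter> T)) = \<one>\<^bsub>H\<^esub>"
    using hom_mult[OF f, of "finprod G v (S \<inter> T)" "finprod G v (F \<inter> K)"] cl[OF sub(1)] cl[OF sub(2)]
      hom_in_carrier[OF f, of "finprod G v (S \<inter> T)"] by simp
  then show "finprod H (\<lambda>i. f (v i)) (S \<inter> T) = \<one>\<^bsub>H\<^esub>"
    using hom_finprod[OF H f cl[OF sub(1)]] by simp
qed

lemma finprod_nat_pow: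
  assumes "v \<in> A \<rightarrow> carrier G"
  shows "finprod G (\<lambda>i. v i [^] (n::nat)) A = finprod G v A [^] n"
  using assms
proof (induction A rule: infinite_finite_induct)
  case (insert x A)
  then show ?case by (simp add: Pi_iff nat_pow_distrib)
qed auto

lemma ord_eq_prime:
  assumes "prime p" "x \<in> carrier G" "x \<noteq> \<one>" "x [^] p = \<one>"
  shows "ord x = p"
  using assms by (metis ord_eq_1 pow_eq_id prime_nat_iff)

text \<open>
  The special case of the Cauchy-Davenport theorem in which each summand is \<open>{\<one>, y}\<close>: a further
  element \<open>y \<noteq> \<one>\<close> enlarges the set of subset products unless that set is invariant under
  multiplication by \<open>y\<close>, in which case it contains all \<open>p\<close> powers of \<open>y\<close>.
\<close>

lemma prime_group_subset_products:
  assumes p: "prime p" and C: "C \<subseteq> {x \<in> carrier G. x [^] p = \<one>}" "finite C" "card C \<le> p"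
      "\<one> \<in> C" "\<And>x y. x \<in> C \<Longrightarrow> y \<in> C \<Longrightarrow> x \<otimes> y \<in> C"
    and Y: "finite Y" "p \<le> Suc (card Y)" "y \<in> Y \<rightarrow> C - {\<one>}" and c: "c \<in> C"
  shows "\<exists>F\<subseteq>Y. finprod G y F = c"
proof -
  define P where "P Z = finprod G y ` Pow Z" for Z
  have cl: "finprod G y F \<in> C" if "finite F" "F \<subseteq> Y" for F
    using that
  proof (induction F)
    case (insert x F)
    then have "finprod G y (insert x F) = y x \<otimes> finprod G y F"
      using Y C(1) by (intro finprod_insert) (auto simp: Pi_iff)
    then show ?case using insert Y C(5) by (auto simp: Pi_iff)
  qed (use C in simp)
  have PC: "P Z \<subseteq> C" if "Z \<subseteq> Y" for Z
  proof -
    have "finite F" if "F \<subseteq> Z" for F using that \<open>Z \<subseteq> Y\<close> Y(1) by (meson finite_subset)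
    then show ?thesis using cl that unfolding P_def by blast
  qed
  have fP: "finite (P Z)" if "finite Z" for Z using that by (simp add: P_def)
  have grow: "min p (Suc (card Z)) \<le> card (P Z)" if "finite Z" "Z \<subseteq> Y" for Z
    using that
  proof (induction Z)
    case empty
    then show ?case by (simp add: P_def)
  next
    case (insert z Z)
    have yz: "y z \<in> carrier G" "y z \<noteq> \<one>" "y z [^] p = \<one>" "y z \<in> C"
      using insert.prems Y C(1) by (auto simp: Pi_iff)
    have step: "y z \<otimes> g \<in> P (insert z Z)" if gP: "g \<in> P Z" for g
    proof -
      obtain F where F: "F \<subseteq> Z" "g = finprod G y F" using gP unfolding P_def by blast
      have "finite F" "y \<in> F \<rightarrow> carrier G"
        using F insert Y C(1) by (auto simp: Pi_iff intro: finite_subset)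
      then have "finprod G y (insert z F) = y z \<otimes> g"
        using F insert.hyps yz by (subst finprod_insert) auto
      then show ?thesis using F unfolding P_def by (metis Pow_iff image_eqI insert_mono)
    qed
    have sub: "P Z \<subseteq> P (insert z Z)" unfolding P_def by auto
    have fin: "finite (P (insert z Z))" using fP insert.hyps by simp
    show ?case
    proof (cases "\<forall>g\<in>P Z. y z \<otimes> g \<in> P Z")
      case True
      have pow: "y z [^] (n::nat) \<in> P Z" for n
      proof (induction n)
        case 0
        have "finprod G y {} \<in> P Z" unfolding P_def by blast
        then show ?case by simp
      next
        case (Suc n)
        then have "y z \<otimes> y z [^] n \<in> P Z" using True by blast
        then show ?case using yz by (simp add: m_comm)
      qed
      have "ord (y z) = p" using ord_eq_prime p yz by blast
      moreover have "inj_on (\<lambda>n. y z [^] (n::nat)) {0..ord (y z) - 1}"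
        using yz ord_inj by blast
      ultimately have "p = card ((\<lambda>n. y z [^] (n::nat)) ` {0..p - 1})"
        using prime_gt_0_nat[OF p] by (simp add: card_image)
      also have "\<dots> \<le> card (P (insert z Z))"
        using pow sub fin by (intro card_mono) auto
      finally show ?thesis by simp
    next
      case False
      then obtain g where g: "g \<in> P Z" "y z \<otimes> g \<notin> P Z" by blast
      have "card (insert (y z \<otimes> g) (P Z)) \<le> card (P (insert z Z))"
        using sub step[OF g(1)] fin by (intro card_mono) auto
      then have "Suc (card (P Z)) \<le> card (P (insert z Z))"
        using g fP insert.hyps by simp
      then show ?thesis using insert by auto
    qed
  qed
  have "p \<le> card (P Y)" using grow[OF Y(1)] Y(2) by auto
  then have "P Y = C" using PC[of Y] C by (intro card_seteq) auto
  then show ?thesis using c unfolding P_def by blast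
qed

end

context finite_comm_group
begin

lemma ord_pos: "x \<in> carrier G \<Longrightarrow> ord x > 0"
  using ord_ge_1[OF finite_carrier] by force

lemma K1_attained:
  obtains A :: "('a \<times> nat) set" where "uf_family G A fst" "K1 G = family_cross G A fst"
proof -
  have "uf_family G ({} :: ('a \<times> nat) set) fst" by (auto simp: uf_family_def subset_empty)
  then have "UFIS G (mset_set {})" by (rule UFIS_if_uf_family) simp
  then have "K1 G \<in> {cross_number G S | S. UFIS G S}"
    unfolding K1_def using finite_UFIS_cross_numbers by (intro Max_in) auto
  then obtain S where S: "UFIS G S" "K1 G = cross_number G S" by auto
  note u = uf_family_if_UFIS[OF S(1)]
  have "cross_number G (mset_set (set_mset S)) = family_cross G (set_mset S) fst"
    using u(2) by (intro cross_number_mset_set) (auto simp: uf_family_def)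
  then have "K1 G = family_cross G (set_mset S) fst" using S u(1) by metis
  then show ?thesis using that u by blast
qed

lemma cross_number_le_K1: "UFIS G S \<Longrightarrow> cross_number G S \<le> K1 G"
  unfolding K1_def using finite_UFIS_cross_numbers by (intro Max_ge) auto

text \<open>
  The family is relabelled as an indexed sequence and completed by the inverse of its total product.
  Product-one sets containing the new term are the complements of those that avoid it, and the latter
  are closed under unions as well as intersections, so the completed sequence is a UFIS.
\<close>

lemma family_cross_le_K1:
  assumes uf: "uf_family G I v"
  shows "family_cross G I v \<le> K1 G"
proof -
  have fin: "finite I" using uf_familyD(1)[OF uf] .
  obtain h :: "_ \<Rightarrow> nat" where h: "inj_on h I" using finite_imp_inj_to_nat_seg[OF fin] by blast
  \<comment> \<open>Label 0 is kept free for the completing term.\<close>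
  define e where "e i = (v i, Suc (h i))" for i
  have inj: "inj_on e I" using h by (auto simp: e_def inj_on_def)
  define A where "A = e ` I"
  have ufA: "uf_family G A fst"
    unfolding A_def by (rule uf_family_reindex[OF uf inj]) (simp add: e_def)
  have fA: "finite A" using fin by (simp add: A_def)
  have eq: "family_cross G I v = family_cross G A fst"
    unfolding family_cross_def A_def by (subst sum.reindex[OF inj]) (simp add: e_def)
  have clA: "fst \<in> S \<rightarrow> carrier G" if "S \<subseteq> A" for S using uf_familyD(3)[OF ufA] that by blast
  have crossA: "cross_number G (mset_set B) = family_cross G B fst" if "uf_family G B fst" for B
    using that by (intro cross_number_mset_set) (auto simp: uf_family_def)
  show ?thesis
  proof (cases "finprod G fst A = \<one>")
    case True
    then show ?thesis using UFIS_if_uf_family[OF ufA] cross_number_le_K1 crossA[OF ufA] eq by metis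
  next
    case False
    define g where "g = inv (finprod G fst A)"
    have g: "g \<in> carrier G" "g \<noteq> \<one>" using False clA[of A] by (auto simp: g_def inv_eq_1_iff)
    define z where "z = (g, 0::nat)"
    have zA: "z \<notin> A" by (auto simp: z_def A_def e_def)
    let ?B = "insert z A"
    have fsub: "finite S" if "S \<subseteq> A" for S using that fA finite_subset by blast
    have prodz: "finprod G fst (insert z S) = g \<otimes> finprod G fst S" if "S \<subseteq> A" for S
      using that zA clA[OF that] fsub[OF that] g by (subst finprod_insert) (auto simp: z_def)
    have totB: "finprod G fst ?B = \<one>" using prodz[of A] clA[of A] by (simp add: g_def)
    have clB: "fst \<in> S \<rightarrow> carrier G" if "S \<subseteq> ?B" for S using that clA[of A] g by (auto simp: z_def)
    have compl: "finprod G fst (?B - S) = \<one>" if "S \<subseteq> ?B" "finprod G fst S = \<one>" for S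
      using that fA totB clB[of ?B] by (intro finprod_Diff_eq_one) auto
    have Un: "finprod G fst (S \<union> T) = \<one>"
      if ST: "S \<subseteq> A" "T \<subseteq> A" "finprod G fst S = \<one>" "finprod G fst T = \<one>" for S T
    proof -
      have "finprod G fst (T - S \<inter> T) = \<one>"
        using ST fsub clA[of T] uf_familyD(5)[OF ufA ST] by (intro finprod_Diff_eq_one) auto
      moreover have "S \<union> T = S \<union> (T - S \<inter> T)" by auto
      moreover have "finprod G fst (S \<union> (T - S \<inter> T)) = \<one>"
        using ST fsub[of S] fsub[of T] clA[of S] clA[of "T - S \<inter> T"] calculation(1)
        by (intro finprod_Un_eq_one) auto
      ultimately show ?thesis by simp
    qed
    have mixed: "finprod G fst (S \<inter> T) = \<one>"
      if ST: "S \<subseteq> A" "z \<in> T" "T \<subseteq> ?B" "finprod G fst S = \<one>" "finprod G fst T = \<one>" for S T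
    proof -
      have "?B - T \<subseteq> A" using ST by auto
      then have "finprod G fst (S \<inter> (?B - T)) = \<one>"
        using uf_familyD(5)[OF ufA, of S "?B - T"] ST compl[OF ST(3,5)] by blast
      then have "finprod G fst (S - S \<inter> (?B - T)) = \<one>"
        using ST fsub clA[of S] by (intro finprod_Diff_eq_one) auto
      moreover have "S - S \<inter> (?B - T) = S \<inter> T" using ST by auto
      ultimately show ?thesis by simp
    qed
    have "finprod G fst (S \<inter> T) = \<one>"
      if ST: "S \<subseteq> ?B" "T \<subseteq> ?B" "finprod G fst S = \<one>" "finprod G fst T = \<one>" for S T
    proof -
      consider "z \<notin> S" "z \<notin> T" | "z \<notin> S" "z \<in> T" | "z \<in> S" "z \<notin> T" | "z \<in> S" "z \<in> T" by blast
      then show ?thesis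
      proof cases
        case 1 then show ?thesis using ST uf_familyD(5)[OF ufA] by blast
      next
        case 2 then show ?thesis using ST mixed by blast
      next
        case 3 then show ?thesis using ST mixed[of T S] by (simp add: Int_commute subset_insert)
      next
        case 4
        have "?B - S \<subseteq> A" "?B - T \<subseteq> A" using 4 by auto
        then have "finprod G fst ((?B - S) \<union> (?B - T)) = \<one>"
          using compl[OF ST(1,3)] compl[OF ST(2,4)] by (rule Un)
        then have "finprod G fst (?B - ((?B - S) \<union> (?B - T))) = \<one>" by (rule compl[rotated]) auto
        moreover have "?B - ((?B - S) \<union> (?B - T)) = S \<inter> T" using ST by auto
        ultimately show ?thesis by simp
      qed
    qed
    then have ufB: "uf_family G ?B fst"
      using g fA ufA unfolding uf_family_def by (auto simp: z_def nonzero_elems_def)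
    have "family_cross G A fst \<le> family_cross G ?B fst"
      unfolding family_cross_def using fA by (intro sum_mono2) auto
    then show ?thesis
      using UFIS_if_uf_family[OF ufB totB] cross_number_le_K1 crossA[OF ufB] eq by fastforce
  qed
qed

text \<open>
  The hypothesis \<open>reduced\<close> says that no block of terms can be replaced by its product without
  lowering the cross number. Suppose \<open>p + 1\<close> terms have order \<open>m\<close>. Their powers with exponent
  \<open>m div p\<close> have order \<open>p\<close>, and any \<open>p - 1\<close> of these powers produce the whole \<open>p\<close>-torsion subgroup
  as subset products. Hence each term \<open>z\<close> lies, for every other term \<open>z'\<close>, in a set of at most \<open>p\<close>
  terms that omits \<open>z'\<close> and whose product is killed by \<open>m div p\<close>; since the cross number of this set
  is at most \<open>p / m\<close>, its product must be \<open>\<one>\<close>. Intersecting over all \<open>z'\<close> leaves \<open>z\<close> alone with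
  product one, which is impossible.
\<close>

lemma order_class_card_le_prime:
  assumes p: "prime p" and C: "card {x \<in> carrier G. x [^] p = \<one>} \<le> p"
    and uf: "uf_family G I v" and m: "p dvd m"
    and reduced: "\<And>T. T \<subseteq> I \<Longrightarrow> 2 \<le> card T \<Longrightarrow> finprod G v T \<noteq> \<one> \<Longrightarrow>
      1 / real (ord (finprod G v T)) < family_cross G T v"
  shows "card {i \<in> I. ord (v i) = m} \<le> p"
proof (rule ccontr)
  assume "\<not> ?thesis"
  then have "Suc p \<le> card {i \<in> I. ord (v i) = m}" by simp
  then obtain Y where Y: "Y \<subseteq> {i \<in> I. ord (v i) = m}" "card Y = Suc p" "finite Y"
    by (rule obtain_subset_with_card_n)
  define y where "y i = v i [^] (m div p)" for i
  let ?C = "{x \<in> carrier G. x [^] p = \<one>}"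
  have fin: "finite I" using uf_familyD(1)[OF uf] .
  have vY: "v i \<in> carrier G" "ord (v i) = m" if "i \<in> Y" for i using that Y uf_familyD(3)[OF uf] by auto
  obtain i0 where i0: "i0 \<in> Y" using Y(2) by fastforce
  have m0: "m > 0" using ord_pos vY[OF i0] by blast
  have p0: "p > 1" using p prime_gt_1_nat by blast
  have q0: "m div p > 0" using m m0 p0 by (auto elim!: dvdE)
  have y: "y i \<in> ?C - {\<one>}" if "i \<in> Y" for i
  proof -
    have "ord (y i) = p"
      unfolding y_def using vY[OF that] m m0 q0
      by (subst ord_pow) (auto elim!: dvdE)
    moreover have "y i \<in> carrier G" using vY[OF that] by (simp add: y_def)
    ultimately show ?thesis using p0 pow_ord_eq_1[of "y i"] by auto
  qed
  have Cm: "a \<otimes> b \<in> ?C" if "a \<in> ?C" "b \<in> ?C" for a b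
    using that by (simp add: nat_pow_distrib)
  have fC: "finite ?C" using finite_carrier by simp
  have Z: "\<exists>Z\<subseteq>Y. z \<in> Z \<and> z' \<notin> Z \<and> finprod G v Z = \<one>" if z: "z \<in> Y" "z' \<in> Y" "z' \<noteq> z" for z z'
  proof -
    have cardX: "card (Y - {z, z'}) = p - 1" using z Y by (subst card_Diff_subset) auto
    have yz: "y z \<in> carrier G" "y z \<noteq> \<one>" "y z [^] p = \<one>" using y[OF z(1)] by auto
    have "inv (y z) \<in> ?C" using yz by (simp add: nat_pow_inv)
    then have "\<exists>F\<subseteq>Y - {z, z'}. finprod G y F = inv (y z)"
      using Y cardX y fC C Cm p0 by (intro prime_group_subset_products[OF p, of ?C]) auto
    then obtain F where F: "F \<subseteq> Y - {z, z'}" "finprod G y F = inv (y z)" by blast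
    have fF: "finite F" using F Y by (meson finite_Diff finite_subset)
    have yF: "y \<in> F \<rightarrow> carrier G" using F y by auto
    let ?Z = "insert z F"
    have ZY: "?Z \<subseteq> Y" "z \<in> ?Z" "z' \<notin> ?Z" using F z by auto
    have vZ: "v \<in> ?Z \<rightarrow> carrier G" using ZY vY by auto
    have "finprod G y ?Z = y z \<otimes> inv (y z)"
      using F fF yF yz by (subst finprod_insert) auto
    then have one: "finprod G v ?Z [^] (m div p) = \<one>"
      using finprod_nat_pow[OF vZ, of "m div p"] yz by (simp add: y_def[abs_def])
    have "inv (y z) \<noteq> \<one>" using yz(1,2) inv_eq_1_iff by blast
    then have Fne: "F \<noteq> {}" using F(2) by auto
    have "card ?Z \<le> card (Y - {z'})" using ZY Y by (intro card_mono) auto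
    then have cZ: "card ?Z \<le> p" using z Y by simp
    have "finprod G v ?Z = \<one>"
    proof (rule ccontr)
      assume ne: "finprod G v ?Z \<noteq> \<one>"
      have c2: "2 \<le> card ?Z" using Fne fF F card_gt_0_iff[of F] by (auto simp: card_insert_if)
      have cl: "finprod G v ?Z \<in> carrier G" using vZ by (rule finprod_closed)
      have "ord (finprod G v ?Z) dvd m div p" using one cl by (simp add: pow_eq_id)
      then have le: "ord (finprod G v ?Z) \<le> m div p" using q0 by (simp add: dvd_imp_le)
      have "family_cross G ?Z v = (\<Sum>i\<in>?Z. 1 / real m)"
        unfolding family_cross_def using ZY vY by (intro sum.cong) auto
      also have "\<dots> = real (card ?Z) / real m" by simp
      also have "\<dots> \<le> real p / real m" using cZ by (intro divide_right_mono) auto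
      also have "\<dots> = 1 / real (m div p)" using m m0 p0 by (auto elim!: dvdE)
      also have "\<dots> \<le> 1 / real (ord (finprod G v ?Z))"
        using le ord_pos[OF cl] by (intro divide_left_mono) auto
      finally show False using reduced[of ?Z] ZY Y c2 ne by force
    qed
    then show ?thesis using ZY by blast
  qed
  \<comment> \<open>For \<open>X = {}\<close> there is no product-one set to start the intersection from.\<close>
  have inter: "\<exists>Z\<subseteq>Y. i0 \<in> Z \<and> Z \<inter> X = {} \<and> (X \<noteq> {} \<longrightarrow> finprod G v Z = \<one>)"
    if "finite X" "X \<subseteq> Y - {i0}" for X
    using that
  proof (induction X)
    case (insert x X)
    then obtain Z1 where Z1: "Z1 \<subseteq> Y" "i0 \<in> Z1" "Z1 \<inter> X = {}" "X \<noteq> {} \<longrightarrow> finprod G v Z1 = \<one>" by auto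
    obtain Z2 where Z2: "Z2 \<subseteq> Y" "i0 \<in> Z2" "x \<notin> Z2" "finprod G v Z2 = \<one>"
      using Z[of i0 x] insert.prems i0 by auto
    show ?case
    proof (cases "X = {}")
      case True
      then show ?thesis using Z2 by blast
    next
      case False
      have "finprod G v (Z1 \<inter> Z2) = \<one>"
        using uf_familyD(5)[OF uf, of Z1 Z2] Z1 Z2 Y False by blast
      then show ?thesis using Z1 Z2 by (intro exI[of _ "Z1 \<inter> Z2"]) auto
    qed
  qed (use i0 in auto)
  have ne: "Y - {i0} \<noteq> {}" using Y(2,3) p0 i0
    by (metis One_nat_def card.empty card_Suc_Diff1 less_numeral_extra(4) nat.inject not_one_less_zero)
  obtain Z where "Z \<subseteq> Y" "i0 \<in> Z" "Z \<inter> (Y - {i0}) = {}" "finprod G v Z = \<one>"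
    using inter[of "Y - {i0}"] ne Y(3) by auto
  moreover from this have "Z = {i0}" by blast
  ultimately have "finprod G v {i0} = \<one>" by simp
  then have "v i0 = \<one>" using vY[OF i0] by simp
  then show False using uf_familyD(4)[OF uf, of i0] i0 Y by auto
qed

end

section \<open>Direct products with a cyclic group of prime power order\<close>

lemma pow_DirProd: "(x, y) [^]\<^bsub>G \<times>\<times> H\<^esub> (n::nat) = (x [^]\<^bsub>G\<^esub> n, y [^]\<^bsub>H\<^esub> n)"
  by (induction n) (simp_all add: nat_pow_def)

lemma finite_comm_group_DirProd:
  assumes "finite_comm_group G" "finite_comm_group H"
  shows "finite_comm_group (G \<times>\<times> H)"
proof -
  interpret G: finite_comm_group G by fact
  interpret H: finite_comm_group H by fact
  have "comm_group (G \<times>\<times> H)"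
    by (rule group.group_comm_groupI[OF DirProd_group[OF G.is_group H.is_group]])
       (auto simp: G.m_comm H.m_comm)
  then show ?thesis
    using G.finite_carrier H.finite_carrier by (simp add: finite_comm_group_def finite_comm_group_axioms_def)
qed

lemma finite_comm_group_integer_mod_group: "n > 0 \<Longrightarrow> finite_comm_group (integer_mod_group n)"
  by (simp add: finite_comm_group_def finite_comm_group_axioms_def carrier_integer_mod_group)

lemma fst_hom: "fst \<in> hom (G \<times>\<times> H) G" and snd_hom: "snd \<in> hom (G \<times>\<times> H) H"
  by (auto simp: hom_def)

context finite_comm_group
begin

lemma ord_dvd_exponent: "g \<in> carrier G \<Longrightarrow> ord g dvd group_exponent G"
  unfolding group_exponent_def by (rule dvd_Lcm) simp

lemma group_exponent_pos: "group_exponent G > 0"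
proof -
  have "0 \<notin> ord ` carrier G" using ord_pos by fastforce
  then have "group_exponent G \<noteq> 0"
    unfolding group_exponent_def using finite_carrier by (simp add: Lcm_0_iff)
  then show ?thesis by simp
qed

end

text \<open>
  The right-hand side is the product over \<open>q\<close> of the geometric sums of \<open>1 / q ^ k\<close> with \<open>k\<close> up to the
  multiplicity of \<open>q\<close>. Expanding it gives one summand for each choice of exponents, and the divisors
  of \<open>n\<close> correspond to such choices.
\<close>

lemma sum_inverse_divisors_le:
  fixes n :: nat
  assumes "n > 0"
  shows "(\<Sum>d | d dvd n. 1 / real d) \<le>
    (\<Prod>q \<in> prime_factors n. (real q ^ (multiplicity q n + 1) - 1) /
          (real q ^ (multiplicity q n + 1) - real q ^ multiplicity q n))"
proof -
  let ?P = "prime_factors n"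
  have factor: "(\<Sum>k\<le>m. 1 / real q ^ k) = (real q ^ (m + 1) - 1) / (real q ^ (m + 1) - real q ^ m)"
    if "q > 1" for q m :: nat
  proof -
    have "(\<Sum>k\<le>m. 1 / real q ^ k) = (\<Sum>k\<le>m. (1 / real q) ^ k)" by (simp add: power_one_over)
    also have "\<dots> = (1 - (1 / real q) ^ Suc m) / (1 - 1 / real q)"
      using that sum_gp0[of "1 / real q" m] by simp
    also have "\<dots> = (real q ^ (m + 1) - 1) / (real q ^ (m + 1) - real q ^ m)"
      using that by (simp add: field_simps power_one_over)
    finally show ?thesis .
  qed
  define e where "e d = restrict (\<lambda>q. multiplicity q d) ?P" for d :: nat
  have e: "(\<Prod>q\<in>?P. real q ^ e d q) = real d" if d: "d dvd n" for d
  proof -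
    have "d > 0" using that assms by (simp add: dvd_pos_nat)
    have "d = (\<Prod>q\<in>prime_factors d. q ^ multiplicity q d)"
      using \<open>d > 0\<close> by (simp add: prime_factorization_nat)
    also have "\<dots> = (\<Prod>q\<in>?P. q ^ multiplicity q d)"
    proof (rule prod.mono_neutral_left)
      show "prime_factors d \<subseteq> ?P" using d assms by (simp add: dvd_prime_factors)
      show "\<forall>q\<in>?P - prime_factors d. q ^ multiplicity q d = 1"
        using \<open>d > 0\<close> by (auto simp: prime_factors_multiplicity)
    qed simp
    also have "\<dots> = (\<Prod>q\<in>?P. q ^ e d q)" by (intro prod.cong) (simp_all add: e_def)
    finally have "real d = real (\<Prod>q\<in>?P. q ^ e d q)" by (rule arg_cong)
    then show ?thesis by simp
  qed
  have inj: "inj_on e {d. d dvd n}"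
    using e unfolding inj_on_def by (metis mem_Collect_eq of_nat_eq_iff)
  have sub: "e ` {d. d dvd n} \<subseteq> PiE ?P (\<lambda>q. {..multiplicity q n})"
    using assms by (auto simp: e_def intro!: dvd_imp_multiplicity_le)
  have "(\<Sum>d | d dvd n. 1 / real d) = (\<Sum>d | d dvd n. \<Prod>q\<in>?P. 1 / real q ^ e d q)"
    using e by (intro sum.cong) (simp_all add: prod_dividef)
  also have "\<dots> = (\<Sum>f\<in>e ` {d. d dvd n}. \<Prod>q\<in>?P. 1 / real q ^ f q)"
    by (simp add: sum.reindex[OF inj])
  also have "\<dots> \<le> (\<Sum>f\<in>PiE ?P (\<lambda>q. {..multiplicity q n}). \<Prod>q\<in>?P. 1 / real q ^ f q)"
    using sub by (intro sum_mono2) (auto intro!: finite_PiE prod_nonneg)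
  also have "\<dots> = (\<Prod>q\<in>?P. \<Sum>k\<le>multiplicity q n. 1 / real q ^ k)"
    by (subst prod_sum_PiE) auto
  also have "\<dots> = (\<Prod>q \<in> ?P. (real q ^ (multiplicity q n + 1) - 1) /
          (real q ^ (multiplicity q n + 1) - real q ^ multiplicity q n))"
    by (intro prod.cong factor refl) (simp add: in_prime_factors_iff prime_gt_Suc_0_nat)
  finally show ?thesis .
qed

locale coprime_prime_group = finite_comm_group G for G (structure) +
  fixes p :: nat
  assumes prime_p: "prime p" and not_dvd: "\<not> p dvd group_exponent G"
begin

definition H :: "nat \<Rightarrow> (int \<times> 'a) monoid" where
  "H \<alpha> = integer_mod_group (p ^ \<alpha>) \<times>\<times> G"

abbreviation "hord \<alpha> \<equiv> group.ord (H \<alpha>)"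

lemma p_gt_1: "p > 1"
  using prime_p prime_gt_1_nat by blast

lemma H_group: "finite_comm_group (H \<alpha>)"
  unfolding H_def using p_gt_1 finite_comm_group_axioms
  by (intro finite_comm_group_DirProd finite_comm_group_integer_mod_group) auto

lemma H_comm_group: "comm_group (H \<alpha>)"
  using H_group finite_comm_group_def by blast

lemma carrier_H: "(x, g) \<in> carrier (H \<alpha>) \<longleftrightarrow> 0 \<le> x \<and> x < int p ^ \<alpha> \<and> g \<in> carrier G"
  unfolding H_def using p_gt_1 by (auto simp: carrier_integer_mod_group)

lemma one_H: "\<one>\<^bsub>H \<alpha>\<^esub> = (0, \<one>)"
  by (simp add: H_def)

lemma mult_H: "(x, g) \<otimes>\<^bsub>H \<alpha>\<^esub> (y, h) = ((x + y) mod int p ^ \<alpha>, g \<otimes> h)"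
  by (simp add: H_def)

lemma pow_H: "(x, g) [^]\<^bsub>H \<alpha>\<^esub> (n::nat) = (int n * x mod int p ^ \<alpha>, g [^] n)"
  by (simp add: H_def pow_DirProd)

lemma ord_H_dvd:
  assumes "h \<in> carrier (H \<alpha>)"
  shows "hord \<alpha> h dvd p ^ \<alpha> * group_exponent G"
proof -
  interpret H: finite_comm_group "H \<alpha>" by (rule H_group)
  obtain x g where h: "h = (x, g)" by (cases h)
  have "g [^] (p ^ \<alpha> * group_exponent G) = \<one>"
    using assms ord_dvd_exponent[of g] by (subst pow_eq_id) (auto simp: h carrier_H)
  then have "h [^]\<^bsub>H \<alpha>\<^esub> (p ^ \<alpha> * group_exponent G) = \<one>\<^bsub>H \<alpha>\<^esub>"
    by (simp add: h pow_H one_H)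
  then show ?thesis using assms H.pow_eq_id by blast
qed

lemma prime_coprime_exponent: "coprime p (group_exponent G)"
  using prime_p not_dvd by (simp add: prime_imp_coprime)

lemma ord_H_cases:
  assumes "h \<in> carrier (H \<alpha>)"
  obtains l d where "l \<le> \<alpha>" "d dvd group_exponent G" "hord \<alpha> h = p ^ l * d"
proof -
  obtain a d where "hord \<alpha> h = a * d" "a dvd p ^ \<alpha>" "d dvd group_exponent G"
    using division_decomp[OF ord_H_dvd[OF assms]] by blast
  moreover obtain l where "l \<le> \<alpha>" "a = p ^ l"
    using calculation(2) divides_primepow_nat[OF prime_p] by blast
  ultimately show ?thesis using that by blast
qed

lemma pow_p_eq_one_imp:
  assumes "g \<in> carrier G" "g [^] p = \<one>"
  shows "g = \<one>"
proof -
  have "ord g dvd p" using assms by (simp add: pow_eq_id)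
  then have "is_unit (ord g)"
    using ord_dvd_exponent[OF assms(1)] coprime_common_divisor[OF prime_coprime_exponent] by blast
  then have "ord g = 1" by simp
  then show ?thesis using assms ord_eq_1 by blast
qed

text \<open>
  The terms of order prime to \<open>p\<close> are those that lie in the summand \<open>G\<close>.
\<close>

lemma level_zero_fst:
  assumes "h \<in> carrier (H \<alpha>)" "\<not> p dvd hord \<alpha> h"
  shows "fst h = 0" "hord \<alpha> h = ord (snd h)"
proof -
  interpret H: finite_comm_group "H \<alpha>" by (rule H_group)
  obtain x g where h: "h = (x, g)" by (cases h)
  obtain l d where ld: "l \<le> \<alpha>" "d dvd group_exponent G" "hord \<alpha> h = p ^ l * d"
    using ord_H_cases[OF assms(1)] .
  then have "l = 0" using assms(2) by (cases l) auto
  then have "hord \<alpha> h dvd group_exponent G" using ld by simp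
  then have "h [^]\<^bsub>H \<alpha>\<^esub> group_exponent G = \<one>\<^bsub>H \<alpha>\<^esub>" using assms H.pow_eq_id by blast
  then have "int p ^ \<alpha> dvd int (group_exponent G) * x" by (simp add: h pow_H one_H dvd_eq_mod_eq_0)
  moreover have "coprime (int p ^ \<alpha>) (int (group_exponent G))"
    using prime_coprime_exponent by simp
  ultimately have "int p ^ \<alpha> dvd x" by (simp add: coprime_dvd_mult_right_iff)
  moreover have "0 \<le> x" "x < int p ^ \<alpha>" using assms(1) by (simp_all add: h carrier_H)
  ultimately have x: "x = 0" using zdvd_imp_le[of "int p ^ \<alpha>" x] by linarith
  then show "fst h = 0" by (simp add: h)
  have g: "g \<in> carrier G" using assms(1) by (simp add: h carrier_H)
  have "h [^]\<^bsub>H \<alpha>\<^esub> n = \<one>\<^bsub>H \<alpha>\<^esub> \<longleftrightarrow> ord g dvd n" for n :: nat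
    using x g by (simp add: h pow_H one_H pow_eq_id)
  then show "hord \<alpha> h = ord (snd h)" using H.ord_unique[OF assms(1)] by (simp add: h)
qed

lemma level_zero_bound:
  assumes uf: "uf_family (H \<alpha>) I v" and lz: "\<And>i. i \<in> I \<Longrightarrow> \<not> p dvd hord \<alpha> (v i)"
  shows "family_cross (H \<alpha>) I v \<le> K1 G"
proof -
  interpret H: finite_comm_group "H \<alpha>" by (rule H_group)
  note v = uf_familyD(3)[OF uf]
  have "uf_family G (I - {}) (\<lambda>i. snd (v i))"
  proof (rule H.uf_family_hom_image[OF uf comm_group_axioms])
    show "snd \<in> hom (H \<alpha>) G" unfolding H_def by (rule snd_hom)
  next
    fix T assume T: "T \<subseteq> I - {}" "snd (finprod (H \<alpha>) v T) = \<one>"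
    have "v \<in> T \<rightarrow> carrier (H \<alpha>)" using T v by auto
    then have "fst (finprod (H \<alpha>) v T) = finprod (integer_mod_group (p ^ \<alpha>)) (\<lambda>i. fst (v i)) T"
      by (intro H.hom_finprod[OF abelian_integer_mod_group]) (simp_all add: H_def fst_hom)
    also have "\<dots> = \<one>\<^bsub>integer_mod_group (p ^ \<alpha>)\<^esub>"
      using T level_zero_fst(1)[OF v lz]
      by (intro comm_monoid.finprod_one_eqI comm_group.axioms(1) abelian_integer_mod_group) auto
    finally have "finprod (H \<alpha>) v T = \<one>\<^bsub>H \<alpha>\<^esub>" using T by (simp add: prod_eq_iff one_H)
    then show "\<exists>F\<subseteq>{}. finprod (H \<alpha>) v T \<otimes>\<^bsub>H \<alpha>\<^esub> finprod (H \<alpha>) v F = \<one>\<^bsub>H \<alpha>\<^esub>"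
      by (intro exI[of _ "{}"]) (metis H.finprod_empty H.one_closed H.r_one subset_refl)
  next
    fix i assume i: "i \<in> I - {}"
    then show "snd (v i) \<noteq> \<one>"
      using level_zero_fst(1)[OF v lz, of i] uf_familyD(4)[OF uf, of i] by (auto simp: prod_eq_iff one_H)
  qed auto
  then have "family_cross G I (\<lambda>i. snd (v i)) \<le> K1 G" using family_cross_le_K1 by simp
  moreover have "family_cross (H \<alpha>) I v = family_cross G I (\<lambda>i. snd (v i))"
    unfolding family_cross_def using level_zero_fst(2)[OF v lz] by (intro sum.cong) auto
  ultimately show ?thesis by simp
qed

lemma card_p_torsion: "card {h \<in> carrier (H \<alpha>). h [^]\<^bsub>H \<alpha>\<^esub> p = \<one>\<^bsub>H \<alpha>\<^esub>} \<le> p"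
proof -
  have "{h \<in> carrier (H \<alpha>). h [^]\<^bsub>H \<alpha>\<^esub> p = \<one>\<^bsub>H \<alpha>\<^esub>} \<subseteq> (\<lambda>k. (int k * int p ^ (\<alpha> - 1), \<one>)) ` {..<p}"
  proof
    fix h assume h': "h \<in> {h \<in> carrier (H \<alpha>). h [^]\<^bsub>H \<alpha>\<^esub> p = \<one>\<^bsub>H \<alpha>\<^esub>}"
    obtain x g where h: "h = (x, g)" by (cases h)
    have x: "0 \<le> x" "x < int p ^ \<alpha>" "g \<in> carrier G" using h' by (auto simp: h carrier_H)
    have e: "int p * x mod int p ^ \<alpha> = 0" "g [^] p = \<one>" using h' by (auto simp: h pow_H one_H)
    have g: "g = \<one>" using e x pow_p_eq_one_imp by blast
    have "\<exists>k<p. x = int k * int p ^ (\<alpha> - 1)"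
    proof (cases \<alpha>)
      case 0
      then show ?thesis using x p_gt_1 by (intro exI[of _ 0]) auto
    next
      case (Suc a)
      then have "int p * int p ^ a dvd int p * x" using e by (simp add: dvd_eq_mod_eq_0)
      then have "int p ^ a dvd x" using p_gt_1 by simp
      then obtain k where k: "x = k * int p ^ a" by (metis dvdE mult.commute)
      have pos: "int p ^ a > 0" using p_gt_1 by simp
      have "k \<ge> 0" using k x(1) pos by (simp add: zero_le_mult_iff)
      moreover have "k < int p" using k x(2) pos by (simp add: Suc)
      ultimately show ?thesis using k Suc by (intro exI[of _ "nat k"]) auto
    qed
    then show "h \<in> (\<lambda>k. (int k * int p ^ (\<alpha> - 1), \<one>)) ` {..<p}" using g h by auto
  qed
  then have "card {h \<in> carrier (H \<alpha>). h [^]\<^bsub>H \<alpha>\<^esub> p = \<one>\<^bsub>H \<alpha>\<^esub>}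
      \<le> card ((\<lambda>k. (int k * int p ^ (\<alpha> - 1), \<one>)) ` {..<p})"
    by (intro card_mono) auto
  also have "\<dots> \<le> card {..<p}" by (intro card_image_le) simp
  finally show ?thesis by simp
qed

text \<open>
  Reduction modulo \<open>p ^ a\<close> in the first component realizes the quotient of \<open>H (Suc a)\<close> by its
  \<open>p\<close>-torsion, with values in \<open>H a\<close>.
\<close>

definition mod_p_torsion :: "nat \<Rightarrow> int \<times> 'a \<Rightarrow> int \<times> 'a" where
  "mod_p_torsion a h = (fst h mod int p ^ a, snd h)"

lemma mod_p_torsion_hom: "mod_p_torsion a \<in> hom (H (Suc a)) (H a)"
proof (rule homI)
  fix h assume "h \<in> carrier (H (Suc a))"
  then show "mod_p_torsion a h \<in> carrier (H a)"
    using p_gt_1 by (cases h) (simp add: mod_p_torsion_def carrier_H)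
next
  fix h k
  have "int p ^ a dvd int p ^ Suc a" by simp
  then show "mod_p_torsion a (h \<otimes>\<^bsub>H (Suc a)\<^esub> k) = mod_p_torsion a h \<otimes>\<^bsub>H a\<^esub> mod_p_torsion a k"
    by (cases h; cases k) (simp add: mod_p_torsion_def mult_H mod_mod_cancel mod_add_eq del: power_Suc)
qed

lemma mod_p_torsion_eq_one_iff:
  assumes "h \<in> carrier (H (Suc a))"
  shows "mod_p_torsion a h = \<one>\<^bsub>H a\<^esub> \<longleftrightarrow> h [^]\<^bsub>H (Suc a)\<^esub> p = \<one>\<^bsub>H (Suc a)\<^esub>"
proof -
  obtain x g where h: "h = (x, g)" by (cases h)
  have g: "g \<in> carrier G" using assms by (simp add: h carrier_H)
  have "g [^] p = \<one> \<longleftrightarrow> g = \<one>" using pow_p_eq_one_imp[OF g] by auto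
  moreover have "int p * x mod int p ^ Suc a = 0 \<longleftrightarrow> x mod int p ^ a = 0"
    using p_gt_1 by (simp add: dvd_eq_mod_eq_0[symmetric])
  ultimately show ?thesis by (simp add: h pow_H one_H mod_p_torsion_def del: power_Suc)
qed

lemma mod_p_torsion_pow:
  assumes "h \<in> carrier (H (Suc a))"
  shows "mod_p_torsion a (h [^]\<^bsub>H (Suc a)\<^esub> (n::nat)) = mod_p_torsion a h [^]\<^bsub>H a\<^esub> n"
  using hom_nat_pow[OF mod_p_torsion_hom assms comm_group.axioms(2)[OF H_comm_group] comm_group.axioms(2)[OF H_comm_group]] .

text \<open>
  The kernel of the map has exponent \<open>p\<close> and contains all \<open>p\<close>-torsion, so orders divisible by \<open>p\<close>
  lose a factor \<open>p\<close>.
\<close>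

lemma ord_mod_p_torsion_dvd:
  assumes "h \<in> carrier (H (Suc a))"
  shows "hord a (mod_p_torsion a h) dvd hord (Suc a) h"
    and "p dvd hord (Suc a) h \<Longrightarrow> p * hord a (mod_p_torsion a h) dvd hord (Suc a) h"
proof -
  interpret H: finite_comm_group "H (Suc a)" by (rule H_group)
  interpret Q: finite_comm_group "H a" by (rule H_group)
  have fh: "mod_p_torsion a h \<in> carrier (H a)" using assms hom_in_carrier[OF mod_p_torsion_hom] by blast
  show d: "hord a (mod_p_torsion a h) dvd hord (Suc a) h"
    using mod_p_torsion_pow[OF assms, of "hord (Suc a) h"] fh assms hom_one[OF mod_p_torsion_hom H.is_group Q.is_group]
    by (simp only: Q.pow_eq_id[symmetric] H.pow_ord_eq_1)
  assume "p dvd hord (Suc a) h"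
  then obtain m where m: "hord (Suc a) h = m * p" by (metis dvdE mult.commute)
  have "(h [^]\<^bsub>H (Suc a)\<^esub> m) [^]\<^bsub>H (Suc a)\<^esub> p = \<one>\<^bsub>H (Suc a)\<^esub>"
    using assms m H.nat_pow_pow H.pow_ord_eq_1 by metis
  then have "mod_p_torsion a h [^]\<^bsub>H a\<^esub> m = \<one>\<^bsub>H a\<^esub>"
    using mod_p_torsion_eq_one_iff mod_p_torsion_pow assms H.nat_pow_closed by metis
  then have "hord a (mod_p_torsion a h) dvd m" using fh Q.pow_eq_id by blast
  then show "p * hord a (mod_p_torsion a h) dvd hord (Suc a) h" by (simp add: m mult.commute)
qed

text \<open>
  The case of at least \<open>p - 1\<close> terms of order \<open>p\<close>. Their subset products fill the \<open>p\<close>-torsion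
  subgroup, so the other terms remain a uf family modulo this subgroup. A term whose image still has
  order divisible by \<open>p\<close> has at most \<open>1 / p\<close> times the weight of its image, and any other term at most
  the full weight. So the remaining terms weigh at most \<open>1 / p\<close> times the cross number of the quotient
  family plus \<open>1 - 1 / p\<close> times that of its part in \<open>G\<close>. The terms of order \<open>p\<close> themselves weigh at most 1.
\<close>

lemma cross_bound_via_quotient:
  fixes v :: "'i \<Rightarrow> int \<times> 'a"
  assumes IH: "\<And>(J :: 'i set) w. uf_family (H a) J w \<Longrightarrow> family_cross (H a) J w \<le> (\<Sum>j<a. 1 / real p ^ j) + K1 G"
    and uf: "uf_family (H (Suc a)) I v"
    and E: "p \<le> Suc (card {i \<in> I. hord (Suc a) (v i) = p})" "card {i \<in> I. hord (Suc a) (v i) = p} \<le> p"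
  shows "family_cross (H (Suc a)) I v \<le> (\<Sum>j<Suc a. 1 / real p ^ j) + K1 G"
proof -
  interpret H: finite_comm_group "H (Suc a)" by (rule H_group)
  interpret Q: finite_comm_group "H a" by (rule H_group)
  define E where "E = {i \<in> I. hord (Suc a) (v i) = p}"
  let ?C = "{h \<in> carrier (H (Suc a)). h [^]\<^bsub>H (Suc a)\<^esub> p = \<one>\<^bsub>H (Suc a)\<^esub>}"
  note v = uf_familyD(3)[OF uf]
  have fin: "finite I" "finite E" using uf_familyD(1)[OF uf] by (auto simp: E_def)
  have vE: "v i \<in> ?C - {\<one>\<^bsub>H (Suc a)\<^esub>}" if "i \<in> E" for i
    using that v[of i] uf_familyD(4)[OF uf, of i] H.pow_ord_eq_1[of "v i"] by (auto simp: E_def)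
  let ?w = "\<lambda>i. mod_p_torsion a (v i)"
  have ufQ: "uf_family (H a) (I - E) ?w"
  proof (rule H.uf_family_hom_image[OF uf Q.comm_group_axioms mod_p_torsion_hom])
    show "E \<subseteq> I" by (auto simp: E_def)
    show "mod_p_torsion a (v i) = \<one>\<^bsub>H a\<^esub>" if "i \<in> E" for i
      using vE[OF that] mod_p_torsion_eq_one_iff[of "v i" a] by blast
    show "mod_p_torsion a (v i) \<noteq> \<one>\<^bsub>H a\<^esub>" if "i \<in> I - E" for i
    proof
      assume "mod_p_torsion a (v i) = \<one>\<^bsub>H a\<^esub>"
      then have "v i [^]\<^bsub>H (Suc a)\<^esub> p = \<one>\<^bsub>H (Suc a)\<^esub>"
        using that v mod_p_torsion_eq_one_iff by blast
      then have "hord (Suc a) (v i) = p"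
        using that v uf_familyD(4)[OF uf] prime_p by (intro H.ord_eq_prime) auto
      then show False using that by (auto simp: E_def)
    qed
    fix T assume T: "T \<subseteq> I - E" "mod_p_torsion a (finprod (H (Suc a)) v T) = \<one>\<^bsub>H a\<^esub>"
    have cl: "finprod (H (Suc a)) v T \<in> carrier (H (Suc a))"
      using T v by (intro H.finprod_closed) auto
    have "finprod (H (Suc a)) v T \<in> ?C" using T cl mod_p_torsion_eq_one_iff by blast
    then have "inv\<^bsub>H (Suc a)\<^esub> (finprod (H (Suc a)) v T) \<in> ?C"
      by (simp add: H.nat_pow_inv)
    moreover have "x \<otimes>\<^bsub>H (Suc a)\<^esub> y \<in> ?C" if "x \<in> ?C" "y \<in> ?C" for x y
      using that by (simp add: H.nat_pow_distrib)
    moreover have "\<one>\<^bsub>H (Suc a)\<^esub> \<in> ?C" using H.nat_pow_one H.one_closed by blast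
    moreover have "finite ?C" using H.finite_carrier by simp
    moreover have "v \<in> E \<rightarrow> ?C - {\<one>\<^bsub>H (Suc a)\<^esub>}" using vE by blast
    ultimately have "\<exists>F\<subseteq>E. finprod (H (Suc a)) v F = inv\<^bsub>H (Suc a)\<^esub> (finprod (H (Suc a)) v T)"
      using E fin(2) card_p_torsion unfolding E_def[symmetric]
      by (intro H.prime_group_subset_products[OF prime_p subset_refl[of ?C]])
    then obtain F where "F \<subseteq> E" "finprod (H (Suc a)) v F = inv\<^bsub>H (Suc a)\<^esub> (finprod (H (Suc a)) v T)"
      by blast
    then show "\<exists>F\<subseteq>E. finprod (H (Suc a)) v T \<otimes>\<^bsub>H (Suc a)\<^esub> finprod (H (Suc a)) v F = \<one>\<^bsub>H (Suc a)\<^esub>"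
      using cl by (intro exI[of _ F]) simp
  qed
  \<comment> \<open>The terms whose image lies in the summand \<open>G\<close>.\<close>
  define Q0 where "Q0 = {i \<in> I - E. \<not> p dvd hord a (?w i)}"
  have ufQ0: "uf_family (H a) Q0 ?w" by (rule uf_family_subset[OF ufQ]) (auto simp: Q0_def)
  have kQ: "family_cross (H a) (I - E) ?w \<le> (\<Sum>j<a. 1 / real p ^ j) + K1 G" by (rule IH[OF ufQ])
  have kQ0: "family_cross (H a) Q0 ?w \<le> K1 G" by (rule level_zero_bound[OF ufQ0]) (simp add: Q0_def)
  have pointwise: "1 / real (hord (Suc a) (v i)) \<le> (1 / p) * (1 / real (hord a (?w i)))
      + (1 - 1 / p) * (if p dvd hord a (?w i) then 0 else 1 / real (hord a (?w i)))" if i: "i \<in> I - E" for i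
  proof -
    have vi: "v i \<in> carrier (H (Suc a))" using i v by blast
    have wi: "?w i \<in> carrier (H a)" using hom_in_carrier[OF mod_p_torsion_hom vi] .
    have pos: "hord (Suc a) (v i) > 0" "hord a (?w i) > 0" using H.ord_pos[OF vi] Q.ord_pos[OF wi] .
    show ?thesis
    proof (cases "p dvd hord a (?w i)")
      case True
      then have "p dvd hord (Suc a) (v i)" using ord_mod_p_torsion_dvd(1)[OF vi] dvd_trans by blast
      then have "p * hord a (?w i) \<le> hord (Suc a) (v i)"
        using ord_mod_p_torsion_dvd(2)[OF vi] pos by (intro dvd_imp_le) auto
      then have "1 / real (hord (Suc a) (v i)) \<le> 1 / real (p * hord a (?w i))"
        using pos p_gt_1 by (intro divide_left_mono) (auto simp del: of_nat_mult)
      then show ?thesis using True by simp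
    next
      case False
      have "hord a (?w i) \<le> hord (Suc a) (v i)"
        using ord_mod_p_torsion_dvd(1)[OF vi] pos by (intro dvd_imp_le) auto
      then have "1 / real (hord (Suc a) (v i)) \<le> 1 / real (hord a (?w i))"
        using pos by (intro divide_left_mono) auto
      moreover have "(1 / p) * x + (1 - 1 / p) * x = x" for x :: real
        by (simp add: left_diff_distrib)
      ultimately show ?thesis using False by (simp only: if_False)
    qed
  qed
  have "(\<Sum>i\<in>I - E. 1 / real (hord (Suc a) (v i)))
     \<le> (\<Sum>i\<in>I - E. (1 / p) * (1 / real (hord a (?w i)))
      + (1 - 1 / p) * (if p dvd hord a (?w i) then 0 else 1 / real (hord a (?w i))))"
    by (intro sum_mono pointwise)
  also have "\<dots> = (1 / p) * family_cross (H a) (I - E) ?w + (1 - 1 / p) *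
      (\<Sum>i\<in>I - E. if p dvd hord a (?w i) then 0 else 1 / real (hord a (?w i)))"
    unfolding family_cross_def by (simp only: sum.distrib sum_distrib_left)
  also have "(\<Sum>i\<in>I - E. if p dvd hord a (?w i) then 0 else 1 / real (hord a (?w i))) = family_cross (H a) Q0 ?w"
    unfolding family_cross_def Q0_def using fin by (intro sum.mono_neutral_cong_right) auto
  also have "(1 / p) * family_cross (H a) (I - E) ?w + (1 - 1 / p) * family_cross (H a) Q0 ?w
     \<le> (1 / p) * ((\<Sum>j<a. 1 / real p ^ j) + K1 G) + (1 - 1 / p) * K1 G"
    using kQ kQ0 p_gt_1 by (intro add_mono mult_left_mono) auto
  also have "\<dots> = (\<Sum>j<a. 1 / real p ^ Suc j) + K1 G"
    using p_gt_1 by (simp add: algebra_simps sum_distrib_left diff_divide_distrib)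
  finally have rest: "(\<Sum>i\<in>I - E. 1 / real (hord (Suc a) (v i))) \<le> (\<Sum>j<a. 1 / real p ^ Suc j) + K1 G" .
  have "(\<Sum>i\<in>E. 1 / real (hord (Suc a) (v i))) = (\<Sum>i\<in>E. 1 / real p)"
    by (intro sum.cong) (auto simp: E_def)
  also have "\<dots> \<le> 1" using E p_gt_1 by (simp add: E_def)
  finally have top: "(\<Sum>i\<in>E. 1 / real (hord (Suc a) (v i))) \<le> 1" .
  have "family_cross (H (Suc a)) I v = (\<Sum>i\<in>I - E. 1 / real (hord (Suc a) (v i))) + (\<Sum>i\<in>E. 1 / real (hord (Suc a) (v i)))"
    unfolding family_cross_def using fin by (intro sum.subset_diff) (auto simp: E_def)
  also have "\<dots> \<le> (\<Sum>j<Suc a. 1 / real p ^ j) + K1 G"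
    using rest top by (subst sum.lessThan_Suc_shift) simp
  finally show ?thesis .
qed

text \<open>
  The case of at most \<open>p - 2\<close> terms of order \<open>p\<close>. The terms of order prime to \<open>p\<close> form a uf family
  over \<open>G\<close>. The others have order \<open>p ^ l * d\<close> with \<open>1 \<le> l\<close> and \<open>d\<close> dividing the exponent of \<open>G\<close>, and
  there are at most \<open>p\<close> of each order, with two missing for \<open>l = d = 1\<close>. Thus their weight is at most
  \<open>A * D - 2 / p\<close>, where \<open>A = (\<Sum>j<\<alpha>. 1 / p ^ j)\<close> and \<open>D\<close> is the sum of the reciprocals of the divisors.
  By hypothesis \<open>D - 1\<close> is at most \<open>2 * (p - 1) / p ^ 2\<close>, and \<open>A \<le> p / (p - 1)\<close>, so the excess
  \<open>A * (D - 1)\<close> is compensated by \<open>2 / p\<close>.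
\<close>

lemma cross_bound_by_counting:
  assumes wide: "(\<Sum>d | d dvd group_exponent G. 1 / real d) \<le> (real p ^ 2 + 2 * real p - 2) / real p ^ 2"
    and uf: "uf_family (H \<alpha>) I v"
    and classes: "\<And>m. p dvd m \<Longrightarrow> card {i \<in> I. hord \<alpha> (v i) = m} \<le> p"
    and few: "card {i \<in> I. hord \<alpha> (v i) = p} + 2 \<le> p"
  shows "family_cross (H \<alpha>) I v \<le> (\<Sum>j<\<alpha>. 1 / real p ^ j) + K1 G"
proof -
  interpret H: finite_comm_group "H \<alpha>" by (rule H_group)
  note v = uf_familyD(3)[OF uf]
  have fin: "finite I" using uf_familyD(1)[OF uf] .
  let ?n = "group_exponent G"
  define I0 where "I0 = {i \<in> I. \<not> p dvd hord \<alpha> (v i)}"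
  define I1 where "I1 = {i \<in> I. p dvd hord \<alpha> (v i)}"
  define A where "A = (\<Sum>j<\<alpha>. 1 / real p ^ j)"
  define D where "D = (\<Sum>d | d dvd ?n. 1 / real d)"
  have finD: "finite {d. d dvd ?n}" using group_exponent_pos by simp
  have split: "family_cross (H \<alpha>) I v = family_cross (H \<alpha>) I0 v + (\<Sum>i\<in>I1. 1 / real (hord \<alpha> (v i)))"
    unfolding family_cross_def I0_def I1_def using fin
    by (subst sum.union_disjoint[symmetric]) (auto intro!: sum.cong)
  have "family_cross (H \<alpha>) I0 v \<le> K1 G"
    by (rule level_zero_bound[OF uf_family_subset[OF uf]]) (auto simp: I0_def)
  moreover have "(\<Sum>i\<in>I1. 1 / real (hord \<alpha> (v i))) \<le> A"
  proof (cases "\<alpha> = 0")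
    case True
    have "I1 = {}"
    proof (rule ccontr)
      assume "I1 \<noteq> {}"
      then obtain i where i: "i \<in> I" "p dvd hord \<alpha> (v i)" by (auto simp: I1_def)
      then have "p dvd ?n" using ord_H_dvd[OF v[OF i(1)]] True by (metis dvd_trans mult_1 power_0)
      then show False using not_dvd by simp
    qed
    then show ?thesis by (simp add: A_def True)
  next
    case False
    have "\<forall>i\<in>I. \<exists>y. fst y \<le> \<alpha> \<and> snd y dvd ?n \<and> hord \<alpha> (v i) = p ^ fst y * snd y"
    proof
      fix i assume "i \<in> I"
      then obtain l d where "l \<le> \<alpha>" "d dvd ?n" "hord \<alpha> (v i) = p ^ l * d"
        using ord_H_cases v by blast
      then show "\<exists>y. fst y \<le> \<alpha> \<and> snd y dvd ?n \<and> hord \<alpha> (v i) = p ^ fst y * snd y"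
        by (intro exI[of _ "(l, d)"]) simp
    qed
    then obtain ld where ld: "fst (ld i) \<le> \<alpha>" "snd (ld i) dvd ?n"
        "hord \<alpha> (v i) = p ^ fst (ld i) * snd (ld i)" if "i \<in> I" for i
      by metis
    have range: "ld ` I1 \<subseteq> {1..\<alpha>} \<times> {d. d dvd ?n}"
    proof
      fix y assume "y \<in> ld ` I1"
      then obtain i where i: "i \<in> I" "p dvd hord \<alpha> (v i)" "y = ld i" by (auto simp: I1_def)
      have "fst (ld i) \<noteq> 0"
      proof
        assume "fst (ld i) = 0"
        then have "p dvd snd (ld i)" using ld(3)[OF i(1)] i(2) by simp
        then show False using ld(2)[OF i(1)] not_dvd dvd_trans by blast
      qed
      then show "y \<in> {1..\<alpha>} \<times> {d. d dvd ?n}" using ld[OF i(1)] i(3) by (auto simp: mem_Times_iff)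
    qed
    \<comment> \<open>The bound on the total weight of the terms of order \<open>p ^ l * d\<close>.\<close>
    let ?b = "\<lambda>(l, d). (if (l, d) = (1, 1) then real p - 2 else real p) / real (p ^ l * d)"
    have "(\<Sum>i\<in>I1. 1 / real (hord \<alpha> (v i)))
        = (\<Sum>y\<in>{1..\<alpha>} \<times> {d. d dvd ?n}. \<Sum>i\<in>{i\<in>I1. ld i = y}. 1 / real (hord \<alpha> (v i)))"
      using range fin finD by (intro sum.group[symmetric]) (auto simp: I1_def)
    also have "\<dots> \<le> (\<Sum>y\<in>{1..\<alpha>} \<times> {d. d dvd ?n}. ?b y)"
    proof (rule sum_mono)
      fix y assume y: "y \<in> {1..\<alpha>} \<times> {d. d dvd ?n}"
      obtain l d where ldy: "y = (l, d)" by (cases y)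
      let ?F = "{i\<in>I1. ld i = y}"
      have sub: "?F \<subseteq> {i \<in> I. hord \<alpha> (v i) = p ^ l * d}"
      proof
        fix i assume "i \<in> ?F"
        then have "i \<in> I" "ld i = (l, d)" by (auto simp: I1_def ldy)
        then show "i \<in> {i \<in> I. hord \<alpha> (v i) = p ^ l * d}" using ld(3)[of i] by simp
      qed
      have "card ?F \<le> card {i \<in> I. hord \<alpha> (v i) = p ^ l * d}"
        using sub fin by (intro card_mono) auto
      moreover have "p dvd p ^ l * d" using y ldy by (auto intro: dvd_mult2 dvd_power)
      ultimately have "card ?F \<le> p" using classes le_trans by blast
      moreover have "card ?F + 2 \<le> p" if "(l, d) = (1, 1)"
        using that few \<open>card ?F \<le> card _\<close> by simp
      ultimately have le: "real (card ?F) \<le> (if (l, d) = (1, 1) then real p - 2 else real p)"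
        by auto
      have "(\<Sum>i\<in>?F. 1 / real (hord \<alpha> (v i))) = (\<Sum>i\<in>?F. 1 / real (p ^ l * d))"
        using sub by (intro sum.cong) auto
      also have "\<dots> = real (card ?F) / real (p ^ l * d)" by simp
      also have "\<dots> \<le> ?b y" unfolding ldy prod.case using le[unfolded ldy] by (intro divide_right_mono) auto
      finally show "(\<Sum>i\<in>?F. 1 / real (hord \<alpha> (v i))) \<le> ?b y" .
    qed
    also have "\<dots> = (\<Sum>y\<in>{1..\<alpha>} \<times> {d. d dvd ?n}. (case y of (l, d) \<Rightarrow> real p / real (p ^ l * d))
        - (if y = (1, 1) then 2 / real p else 0))"
      by (intro sum.cong) (auto simp: diff_divide_distrib split: if_splits)
    also have "\<dots> = (\<Sum>y\<in>{1..\<alpha>} \<times> {d. d dvd ?n}. case y of (l, d) \<Rightarrow> real p / real (p ^ l * d)) - 2 / real p"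
      using False finD by (simp add: sum_subtractf sum.delta)
    also have "(\<Sum>y\<in>{1..\<alpha>} \<times> {d. d dvd ?n}. case y of (l, d) \<Rightarrow> real p / real (p ^ l * d))
        = (\<Sum>l=1..\<alpha>. \<Sum>d | d dvd ?n. (real p / real p ^ l) * (1 / real d))"
      by (simp add: sum.cartesian_product)
    also have "\<dots> = (\<Sum>l=1..\<alpha>. real p / real p ^ l) * D"
      by (simp only: D_def sum_product)
    also have "(\<Sum>l=1..\<alpha>. real p / real p ^ l) = A"
      unfolding A_def using p_gt_1 
      by (intro sum.reindex_bij_witness[where i = Suc and j = "\<lambda>l. l - 1"]) (auto simp: power_eq_if)
    finally have main: "(\<Sum>i\<in>I1. 1 / real (hord \<alpha> (v i))) \<le> A * D - 2 / real p" .
    have A: "0 \<le> A" "A \<le> real p / (real p - 1)"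
    proof -
      show "0 \<le> A" unfolding A_def by (intro sum_nonneg) auto
      have "A = (\<Sum>j<\<alpha>. (1 / real p) ^ j)" by (simp add: A_def power_one_over)
      also have "\<dots> = (1 - (1 / real p) ^ \<alpha>) / (1 - 1 / real p)"
        using p_gt_1 sum_gp_strict[of "1 / real p" \<alpha>] by simp
      also have "\<dots> \<le> 1 / (1 - 1 / real p)"
        using p_gt_1 by (intro divide_right_mono) auto
      also have "\<dots> = real p / (real p - 1)" using p_gt_1 by (simp add: field_simps)
      finally show "A \<le> real p / (real p - 1)" .
    qed
    have "A * D \<le> A * (1 + 2 * (real p - 1) / real p ^ 2)"
      using A wide p_gt_1 unfolding D_def[symmetric]
      by (intro mult_left_mono) (auto simp: field_simps)
    also have "\<dots> = A + A * (2 * (real p - 1) / real p ^ 2)" by (simp add: algebra_simps)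
    also have "\<dots> \<le> A + real p / (real p - 1) * (2 * (real p - 1) / real p ^ 2)"
      using A p_gt_1 by (intro add_left_mono mult_right_mono) auto
    also have "\<dots> = A + 2 / real p" using p_gt_1 by (simp add: field_simps power2_eq_square)
    finally show ?thesis using main by simp
  qed
  ultimately show ?thesis using split by (simp add: A_def)
qed

text \<open>
  Merging a block whose cross number does not exceed the weight of its product shortens the family
  without lowering its cross number. When no such block is left, every order divisible by \<open>p\<close> occurs at most
  \<open>p\<close> times, and one of the two preceding bounds applies.
\<close>

lemma cross_upper_bound:
  assumes wide: "(\<Sum>d | d dvd group_exponent G. 1 / real d) \<le> (real p ^ 2 + 2 * real p - 2) / real p ^ 2"
    and "uf_family (H \<alpha>) I v"
  shows "family_cross (H \<alpha>) I v \<le> (\<Sum>j<\<alpha>. 1 / real p ^ j) + K1 G"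
  using assms(2)
proof (induction \<alpha> arbitrary: I v rule: less_induct)
  case outer: (less \<alpha>)
  interpret H: finite_comm_group "H \<alpha>" by (rule H_group)
  show ?case
    using outer.prems
  proof (induction "card I" arbitrary: I v rule: less_induct)
    case inner: less
    note uf = inner.prems
    note v = uf_familyD(3)[OF uf]
    have fin: "finite I" using uf_familyD(1)[OF uf] .
    show ?case
    proof (cases "\<exists>T\<subseteq>I. 2 \<le> card T \<and> finprod (H \<alpha>) v T \<noteq> \<one>\<^bsub>H \<alpha>\<^esub> \<and>
        family_cross (H \<alpha>) T v \<le> 1 / real (hord \<alpha> (finprod (H \<alpha>) v T))")
      case True
      then obtain T where T: "T \<subseteq> I" "2 \<le> card T" "finprod (H \<alpha>) v T \<noteq> \<one>\<^bsub>H \<alpha>\<^esub>"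
        "family_cross (H \<alpha>) T v \<le> 1 / real (hord \<alpha> (finprod (H \<alpha>) v T))" by blast
      then obtain t where t: "t \<in> T" by fastforce
      let ?J = "insert t (I - T)" and ?w = "v(t := finprod (H \<alpha>) v T)"
      have ufJ: "uf_family (H \<alpha>) ?J ?w" by (rule H.uf_family_merge[OF uf T(1) t T(3)])
      have fT: "finite T" using T(1) fin finite_subset by blast
      have "card ?J = Suc (card I - card T)" using fin fT T t by (simp add: card_Diff_subset)
      moreover have "card T \<le> card I" using T(1) fin by (simp add: card_mono)
      ultimately have "card ?J < card I" using T(2) by linarith
      then have "family_cross (H \<alpha>) ?J ?w \<le> (\<Sum>j<\<alpha>. 1 / real p ^ j) + K1 G"
        using inner.hyps ufJ by blast
      moreover have "family_cross (H \<alpha>) I v \<le> family_cross (H \<alpha>) ?J ?w"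
      proof -
        have "family_cross (H \<alpha>) I v = (\<Sum>i\<in>I - T. 1 / real (hord \<alpha> (v i))) + family_cross (H \<alpha>) T v"
          unfolding family_cross_def using fin T(1) by (intro sum.subset_diff) auto
        moreover have "(\<Sum>i\<in>I - T. 1 / real (hord \<alpha> (?w i))) = (\<Sum>i\<in>I - T. 1 / real (hord \<alpha> (v i)))"
          using t by (intro sum.cong) auto
        then have "family_cross (H \<alpha>) ?J ?w = 1 / real (hord \<alpha> (finprod (H \<alpha>) v T))
            + (\<Sum>i\<in>I - T. 1 / real (hord \<alpha> (v i)))"
          unfolding family_cross_def using fin t by (subst sum.insert) auto
        ultimately show ?thesis using T(4) by linarith
      qed
      ultimately show ?thesis by linarith
    next
      case False
      have classes: "card {i \<in> I. hord \<alpha> (v i) = m} \<le> p" if "p dvd m" for m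
        using False by (intro H.order_class_card_le_prime[OF prime_p card_p_torsion uf that]) force
      show ?thesis
      proof (cases "card {i \<in> I. hord \<alpha> (v i) = p} + 2 \<le> p")
        case True
        then show ?thesis by (intro cross_bound_by_counting wide uf classes)
      next
        case False
        then have many: "p \<le> Suc (card {i \<in> I. hord \<alpha> (v i) = p})" by linarith
        have "\<alpha> \<noteq> 0"
        proof
          assume "\<alpha> = 0"
          have "{i \<in> I. hord \<alpha> (v i) = p} = {}"
            using ord_H_dvd[OF v] not_dvd unfolding \<open>\<alpha> = 0\<close> by fastforce
          then show False using many p_gt_1 by (simp only: card.empty)
        qed
        then obtain a where "\<alpha> = Suc a" using not0_implies_Suc by blast
        then show ?thesis
          using outer.IH[of a] cross_bound_via_quotient[of a I v] uf many classes[of p] by simp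
      qed
    qed
  qed
qed

end

section \<open>Lower bounds\<close>

context comm_group
begin

lemma uf_family_inj_hom:
  assumes uf: "uf_family G I v" and H: "comm_group H" and f: "f \<in> hom G H" and inj: "inj_on f (carrier G)"
  shows "uf_family H I (\<lambda>i. f (v i))" and "family_cross H I (\<lambda>i. f (v i)) = family_cross G I v"
proof -
  interpret H: comm_group H by fact
  note v = uf_familyD(3)[OF uf]
  have eq1: "f x = \<one>\<^bsub>H\<^esub> \<longleftrightarrow> x = \<one>" if "x \<in> carrier G" for x
    using inj_onD[OF inj, of x \<one>] that hom_one[OF f is_group H.is_group] by auto
  have "uf_family H (I - {}) (\<lambda>i. f (v i))"
  proof (rule uf_family_hom_image[OF uf H f])
    fix T assume T: "T \<subseteq> I - {}" "f (finprod G v T) = \<one>\<^bsub>H\<^esub>"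
    have "finprod G v T = \<one>" using T v eq1[of "finprod G v T"] by (auto simp: Pi_iff subset_iff)
    then show "\<exists>F\<subseteq>{}. finprod G v T \<otimes> finprod G v F = \<one>" by simp
  next
    fix i assume "i \<in> I - {}"
    then show "f (v i) \<noteq> \<one>\<^bsub>H\<^esub>" using v eq1 uf_familyD(4)[OF uf] by auto
  qed auto
  then show "uf_family H I (\<lambda>i. f (v i))" by simp
  have "H.ord (f x) = ord x" if "x \<in> carrier G" for x
  proof -
    have "f x [^]\<^bsub>H\<^esub> n = \<one>\<^bsub>H\<^esub> \<longleftrightarrow> ord x dvd n" for n :: nat
      using that eq1[of "x [^] n"] hom_nat_pow[OF f that is_group H.is_group, of n]
      by (simp add: pow_eq_id)
    then show ?thesis using H.ord_unique hom_in_carrier[OF f that] by blast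
  qed
  then show "family_cross H I (\<lambda>i. f (v i)) = family_cross G I v"
    unfolding family_cross_def using v by (intro sum.cong) auto
qed

end

lemma K1_le_if_inj_hom:
  assumes "finite_comm_group G" "finite_comm_group H" "f \<in> hom G H" "inj_on f (carrier G)"
  shows "K1 G \<le> K1 H"
proof -
  interpret G: finite_comm_group G by fact
  interpret H: finite_comm_group H by fact
  obtain A :: "('a \<times> nat) set" where A: "uf_family G A fst" "K1 G = family_cross G A fst"
    by (rule G.K1_attained)
  then show ?thesis
    using G.uf_family_inj_hom[OF A(1) H.comm_group_axioms assms(3,4)] H.family_cross_le_K1 by metis
qed

lemma K1_DirProd_ge:
  assumes "finite_comm_group A" "finite_comm_group B"
  shows "K1 A + K1 B \<le> K1 (A \<times>\<times> B)"
proof -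
  interpret A: finite_comm_group A by fact
  interpret B: finite_comm_group B by fact
  interpret P: finite_comm_group "A \<times>\<times> B" using assms by (rule finite_comm_group_DirProd)
  obtain I :: "('a \<times> nat) set" where I: "uf_family A I fst" "K1 A = family_cross A I fst"
    by (rule A.K1_attained)
  obtain J :: "('c \<times> nat) set" where J: "uf_family B J fst" "K1 B = family_cross B J fst"
    by (rule B.K1_attained)
  define v where "v = case_sum (\<lambda>i :: 'a \<times> nat. (fst i, \<one>\<^bsub>B\<^esub>)) (\<lambda>j :: 'c \<times> nat. (\<one>\<^bsub>A\<^esub>, fst j))"
  have hA: "(\<lambda>x. (x, \<one>\<^bsub>B\<^esub>)) \<in> hom A (A \<times>\<times> B)" by (auto simp: hom_def)
  have hB: "(\<lambda>y. (\<one>\<^bsub>A\<^esub>, y)) \<in> hom B (A \<times>\<times> B)" by (auto simp: hom_def)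
  note uI = A.uf_family_inj_hom[OF I(1) P.comm_group_axioms hA]
  note uJ = B.uf_family_inj_hom[OF J(1) P.comm_group_axioms hB]
  have ufI: "uf_family (A \<times>\<times> B) (Inl ` I) v"
    by (rule P.uf_family_reindex[OF uI(1)]) (auto simp: v_def inj_on_def)
  have ufJ: "uf_family (A \<times>\<times> B) (Inr ` J) v"
    by (rule P.uf_family_reindex[OF uJ(1)]) (auto simp: v_def inj_on_def)
  have uf: "uf_family (A \<times>\<times> B) (Inl ` I \<union> Inr ` J) v"
  proof (rule P.uf_family_Un[OF ufI ufJ])
    fix T assume T: "T \<subseteq> Inl ` I \<union> Inr ` J" "finprod (A \<times>\<times> B) v T = \<one>\<^bsub>A \<times>\<times> B\<^esub>"
    have fT: "finite T" using T(1) uf_familyD(1)[OF ufI] uf_familyD(1)[OF ufJ] by (simp add: finite_subset)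
    have vT: "v \<in> T \<rightarrow> carrier (A \<times>\<times> B)"
      using T(1) uf_familyD(3)[OF ufI] uf_familyD(3)[OF ufJ] by blast
    \<comment> \<open>The projection to the first factor fixes the terms from \<open>I\<close> and kills those from \<open>J\<close>.\<close>
    let ?f = "\<lambda>h. (fst h, \<one>\<^bsub>B\<^esub>)"
    have hf: "?f \<in> hom (A \<times>\<times> B) (A \<times>\<times> B)" by (auto simp: hom_def)
    have "\<one>\<^bsub>A \<times>\<times> B\<^esub> = ?f (finprod (A \<times>\<times> B) v T)" by (simp add: T(2))
    also have "\<dots> = finprod (A \<times>\<times> B) (\<lambda>i. ?f (v i)) T"
      by (rule P.hom_finprod[OF P.comm_group_axioms hf vT])
    also have "\<dots> = finprod (A \<times>\<times> B) v (T \<inter> Inl ` I)"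
    proof (rule P.finprod_mono_neutral_cong_right)
      show "finite T" by (rule fT)
      show "(\<lambda>i. ?f (v i)) \<in> T \<rightarrow> carrier (A \<times>\<times> B)"
        using vT hom_in_carrier[OF hf] by blast
      show "?f (v i) = \<one>\<^bsub>A \<times>\<times> B\<^esub>" if "i \<in> T - T \<inter> Inl ` I" for i
        using that T(1) by (auto simp: v_def)
      show "?f (v i) = v i" if "i \<in> T \<inter> Inl ` I" for i
        using that by (auto simp: v_def)
    qed auto
    finally show "finprod (A \<times>\<times> B) v (T \<inter> Inl ` I) = \<one>\<^bsub>A \<times>\<times> B\<^esub>" by simp
  qed auto
  have "family_cross (A \<times>\<times> B) (Inl ` I \<union> Inr ` J) v
      = family_cross (A \<times>\<times> B) (Inl ` I) v + family_cross (A \<times>\<times> B) (Inr ` J) v"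
    unfolding family_cross_def using uf_familyD(1)[OF ufI] uf_familyD(1)[OF ufJ]
    by (intro sum.union_disjoint) auto
  also have "family_cross (A \<times>\<times> B) (Inl ` I) v = K1 A"
    using uI(2) I(2) unfolding family_cross_def by (simp add: sum.reindex v_def inj_on_def)
  also have "family_cross (A \<times>\<times> B) (Inr ` J) v = K1 B"
    using uJ(2) J(2) unfolding family_cross_def by (simp add: sum.reindex v_def inj_on_def)
  finally show ?thesis using P.family_cross_le_K1[OF uf] by simp
qed

text \<open>
  A family over the subgroup of multiples of \<open>p\<close> is extended by \<open>p\<close> generators congruent to 1 modulo \<open>p\<close>
  whose sum is 0, namely \<open>p - 1\<close> times 1 and once \<open>1 - p\<close>. Reducing modulo \<open>p\<close>, a zero-sum set contains
  all or none of the new terms, so the new terms form one additional irreducible factor.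
\<close>

lemma K1_cyclic_prime_power_step:
  assumes p: "prime (p::nat)"
  shows "1 / real p ^ a + K1 (integer_mod_group (p ^ a)) \<le> K1 (integer_mod_group (p ^ Suc a))"
proof -
  let ?Z = "integer_mod_group (p ^ a)" and ?Y = "integer_mod_group (p ^ Suc a)"
  have p1: "p > 1" using p prime_gt_1_nat by blast
  interpret Z: finite_comm_group ?Z using p1 by (intro finite_comm_group_integer_mod_group) simp
  interpret Y: finite_comm_group ?Y using p1 by (intro finite_comm_group_integer_mod_group) simp
  interpret C: finite_comm_group "integer_mod_group p" using p1 by (intro finite_comm_group_integer_mod_group) simp
  have carZ: "x \<in> carrier ?Z \<longleftrightarrow> 0 \<le> x \<and> x < int p ^ a" for x
    using p1 by (auto simp: carrier_integer_mod_group)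
  have carY: "x \<in> carrier ?Y \<longleftrightarrow> 0 \<le> x \<and> x < int p ^ Suc a" for x
    using p1 by (auto simp: carrier_integer_mod_group)
  obtain I :: "(int \<times> nat) set" where I: "uf_family ?Z I fst" "K1 ?Z = family_cross ?Z I fst"
    by (rule Z.K1_attained)
  have hf: "(\<lambda>x. int p * x) \<in> hom ?Z ?Y"
  proof (rule homI)
    fix x assume x: "x \<in> carrier ?Z"
    then have "int p * x < int p * int p ^ a" using p1 by (intro mult_strict_left_mono) (auto simp: carZ)
    then show "int p * x \<in> carrier ?Y" using x unfolding carY by (simp add: carZ)
  next
    fix x y
    show "int p * (x \<otimes>\<^bsub>?Z\<^esub> y) = (int p * x) \<otimes>\<^bsub>?Y\<^esub> (int p * y)"
      by (simp add: mult_mod_right distrib_left)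
  qed
  have inj: "inj_on (\<lambda>x. int p * x) (carrier ?Z)" using p1 by (auto simp: inj_on_def)
  note uI = Z.uf_family_inj_hom[OF I(1) Y.comm_group_axioms hf inj]
  let ?g = "\<lambda>j::nat. if j = 0 then (1 - int p) mod int p ^ Suc a else 1"
  define v where "v = case_sum (\<lambda>i::int \<times> nat. int p * fst i) ?g"
  let ?J = "Inr ` {..<p} :: ((int \<times> nat) + nat) set"
  have ufI: "uf_family ?Y (Inl ` I) v"
    by (rule Y.uf_family_reindex[OF uI(1)]) (auto simp: v_def inj_on_def)
  have finI: "finite I" using uf_familyD(1)[OF I(1)] .
  have pa: "int p ^ Suc a > 1" using p1 by (simp add: one_less_power del: power_Suc)
  have g_mod: "?g j mod int p = 1" for j
  proof -
    have "(1 - int p) mod int p ^ Suc a mod int p = (1 - int p) mod int p" by (rule mod_mod_cancel) simp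
    also have "\<dots> = 1" using p1 by (simp add: mod_diff_right_eq[symmetric])
    finally show ?thesis using p1 by simp
  qed
  have vJ: "v i \<in> carrier ?Y" "v i \<noteq> 0" "v i mod int p = 1" if "i \<in> ?J" for i
  proof -
    obtain j where "i = Inr j" using \<open>i \<in> ?J\<close> by blast
    then have j: "v i = ?g j" by (simp add: v_def)
    show m: "v i mod int p = 1" unfolding j by (rule g_mod)
    show "v i \<in> carrier ?Y" unfolding j carY
    proof -
      have "0 < int p ^ Suc a" using p1 by simp
      from pos_mod_sign[OF this, of "1 - int p"] pos_mod_bound[OF this, of "1 - int p"] pa
      show "0 \<le> ?g j \<and> ?g j < int p ^ Suc a" by (cases "j = 0") (simp_all only: if_True if_False, simp_all)
    qed
    show "v i \<noteq> 0" using m by auto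
  qed
  have vI: "v i \<in> carrier ?Y" "v i mod int p = 0" if "i \<in> Inl ` I" for i
    using that uf_familyD(3)[OF ufI that] by (auto simp: v_def)
  have ordJ: "Y.ord (v i) = p ^ Suc a" if "i \<in> ?J" for i
  proof -
    have cop: "coprime (int p ^ Suc a) (v i)"
    proof -
      have "\<not> int p dvd v i" using vJ(3)[OF that] by (simp add: dvd_eq_mod_eq_0)
      then have "coprime (int p) (v i)" using p by (simp add: prime_imp_coprime)
      then show ?thesis by simp
    qed
    have "v i [^]\<^bsub>?Y\<^esub> n = \<one>\<^bsub>?Y\<^esub> \<longleftrightarrow> p ^ Suc a dvd n" for n :: nat
    proof -
      have "v i [^]\<^bsub>?Y\<^esub> n = \<one>\<^bsub>?Y\<^esub> \<longleftrightarrow> int p ^ Suc a dvd int n * v i"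
        by (simp add: dvd_eq_mod_eq_0 del: power_Suc)
      also have "\<dots> \<longleftrightarrow> int (p ^ Suc a) dvd int n"
        using coprime_dvd_mult_left_iff[OF cop] by (simp del: power_Suc)
      finally show ?thesis by (simp only: int_dvd_int_iff)
    qed
    then show ?thesis using Y.ord_unique[OF vJ(1)[OF that]] by blast
  qed
  have red: "(\<lambda>x. x mod int p) \<in> hom ?Y (integer_mod_group p)"
    using p1 by (auto simp: hom_def carY carrier_integer_mod_group mod_mod_cancel mod_add_eq)
  have count: "T \<inter> ?J = {} \<or> T \<inter> ?J = ?J"
    if T: "T \<subseteq> Inl ` I \<union> ?J" "finprod ?Y v T = \<one>\<^bsub>?Y\<^esub>" for T
  proof -
    have fT: "finite T" using T(1) finI by (simp add: finite_subset)
    have vT: "v \<in> T \<rightarrow> carrier ?Y" using T(1) vI vJ by blast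
    have "0 = finprod ?Y v T mod int p" unfolding T(2) by simp
    also have "\<dots> = finprod (integer_mod_group p) (\<lambda>i. v i mod int p) T"
      by (rule Y.hom_finprod[OF C.comm_group_axioms red vT])
    also have "\<dots> = finprod (integer_mod_group p) (\<lambda>i. 1) (T \<inter> ?J)"
      using T(1) fT vI(2) vJ(3) p1
      by (intro C.finprod_mono_neutral_cong_right) (auto simp: carrier_integer_mod_group)
    also have "\<dots> = int (card (T \<inter> ?J)) mod int p"
      using p1 by (subst C.finprod_const) (auto simp: carrier_integer_mod_group)
    finally have "p dvd card (T \<inter> ?J)" by (metis dvd_eq_mod_eq_0 int_dvd_int_iff)
    moreover have cJ: "card ?J = p" by (simp add: card_image)
    ultimately have "card (T \<inter> ?J) = 0 \<or> card (T \<inter> ?J) = card ?J"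
      using card_mono[of ?J "T \<inter> ?J"] by (metis Int_lower2 dvd_imp_le finite_imageI finite_lessThan le_antisym neq0_conv)
    then show ?thesis using card_subset_eq[of ?J "T \<inter> ?J"] by auto
  qed
  have one: "finprod ?Y v ?J = \<one>\<^bsub>?Y\<^esub>"
  proof -
    have J: "?J = insert (Inr 0) (Inr ` {1..<p})" using p1 by (auto simp: image_iff)
    have "finprod ?Y v (Inr ` {1..<p}) = finprod ?Y (\<lambda>_. 1) (Inr ` {1..<p} :: ((int \<times> nat) + nat) set)"
      using pa by (intro Y.finprod_cong') (auto simp: v_def carY simp del: power_Suc)
    also have "\<dots> = int (p - 1) mod int p ^ Suc a"
      using pa by (subst Y.finprod_const) (auto simp: carY card_image simp del: power_Suc)
    finally have s: "finprod ?Y v (Inr ` {1..<p}) = int (p - 1) mod int p ^ Suc a" .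
    have "finprod ?Y v ?J = v (Inr 0) \<otimes>\<^bsub>?Y\<^esub> finprod ?Y v (Inr ` {1..<p})"
      unfolding J using vJ(1) p1 by (intro Y.finprod_insert) auto
    also have "\<dots> = ((1 - int p) + int (p - 1)) mod int p ^ Suc a"
      unfolding s by (simp add: v_def mod_add_eq del: power_Suc)
    also have "\<dots> = 0" using p1 by (simp add: of_nat_diff)
    finally show ?thesis by simp
  qed
  have ufJ: "uf_family ?Y ?J v"
    unfolding uf_family_def
  proof (intro conjI allI impI)
    show "v \<in> ?J \<rightarrow> nonzero_elems ?Y" using vJ by (auto simp: nonzero_elems_def)
    fix S T assume "S \<subseteq> ?J" "T \<subseteq> ?J" "finprod ?Y v S = \<one>\<^bsub>?Y\<^esub>" "finprod ?Y v T = \<one>\<^bsub>?Y\<^esub>"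
    then have "S = {} \<or> S = ?J" "T = {} \<or> T = ?J"
      using count[OF le_supI2, of S] count[OF le_supI2, of T] by (simp_all only: Int_absorb2)
    then have "S \<inter> T = {} \<or> S \<inter> T = ?J" by auto
    then show "finprod ?Y v (S \<inter> T) = \<one>\<^bsub>?Y\<^esub>"
      by (elim disjE) (simp_all only: one Y.finprod_empty)
  qed simp
  have uf: "uf_family ?Y (Inl ` I \<union> ?J) v"
  proof (rule Y.uf_family_Un[OF ufI ufJ])
    fix T assume T: "T \<subseteq> Inl ` I \<union> ?J" "finprod ?Y v T = \<one>\<^bsub>?Y\<^esub>"
    have fT: "finite T" using T(1) finI by (simp add: finite_subset)
    have vT: "v \<in> T \<rightarrow> carrier ?Y" using T(1) vI vJ by blast
    have "finprod ?Y v (T \<inter> ?J) = \<one>\<^bsub>?Y\<^esub>"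
      using count[OF T] by (elim disjE) (simp_all only: one Y.finprod_empty)
    then have "finprod ?Y v (T - T \<inter> ?J) = \<one>\<^bsub>?Y\<^esub>"
      using T fT vT by (intro Y.finprod_Diff_eq_one) auto
    moreover have "T - T \<inter> ?J = T \<inter> Inl ` I" using T(1) by auto
    ultimately show "finprod ?Y v (T \<inter> Inl ` I) = \<one>\<^bsub>?Y\<^esub>" by simp
  qed auto
  have "family_cross ?Y (Inl ` I \<union> ?J) v = family_cross ?Y (Inl ` I) v + family_cross ?Y ?J v"
    unfolding family_cross_def using finI by (intro sum.union_disjoint) auto
  also have "family_cross ?Y (Inl ` I) v = K1 ?Z"
    using uI(2) I(2) unfolding family_cross_def by (simp add: sum.reindex v_def inj_on_def)
  also have "family_cross ?Y ?J v = (\<Sum>i\<in>?J. 1 / real (p ^ Suc a))"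
    unfolding family_cross_def using ordJ by (intro sum.cong) (auto simp del: power_Suc)
  also have "\<dots> = 1 / real p ^ a" using p1 by (simp add: card_image)
  finally show ?thesis using Y.family_cross_le_K1[OF uf] by simp
qed

lemma K1_cyclic_ge:
  assumes "prime (p::nat)"
  shows "(\<Sum>j<\<alpha>. 1 / real p ^ j) \<le> K1 (integer_mod_group (p ^ \<alpha>))"
proof (induction \<alpha>)
  case 0
  interpret Z: finite_comm_group "integer_mod_group (p ^ 0)"
    by (intro finite_comm_group_integer_mod_group) simp
  have "family_cross (integer_mod_group (p ^ 0)) ({} :: nat set) (\<lambda>_. 0) \<le> K1 (integer_mod_group (p ^ 0))"
    by (rule Z.family_cross_le_K1) (auto simp: uf_family_def)
  then show ?case by (simp add: family_cross_def)
next
  case (Suc a)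
  then show ?case using K1_cyclic_prime_power_step[OF assms, of a] by simp
qed

text \<open>
  The upper bound is the general one, applied to the trivial group in place of \<open>G\<close>.
\<close>

lemma K1_cyclic_prime_power:
  assumes p: "prime (p::nat)"
  shows "K1 (integer_mod_group (p ^ \<alpha>)) = (\<Sum>j<\<alpha>. 1 / real p ^ j)"
proof -
  let ?E = "integer_mod_group 1"
  have carE: "carrier ?E = {0}" by (auto simp: carrier_integer_mod_group)
  interpret E: finite_comm_group ?E by (intro finite_comm_group_integer_mod_group) simp
  have "group_exponent ?E = 1"
    unfolding group_exponent_def carE using E.ord_id by simp
  then have ex: "\<not> p dvd group_exponent ?E" "{d. d dvd group_exponent ?E} = {1}"
    using p by (auto simp: not_prime_unit)
  interpret E: coprime_prime_group ?E p by unfold_locales (use p ex in auto)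
  have wide: "(\<Sum>d | d dvd group_exponent ?E. 1 / real d) \<le> (real p ^ 2 + 2 * real p - 2) / real p ^ 2"
    unfolding ex(2) using prime_gt_1_nat[OF p] by (simp add: divide_simps)
  obtain A :: "(int \<times> nat) set" where "uf_family ?E A fst" "K1 ?E = family_cross ?E A fst"
    by (rule E.K1_attained)
  moreover have "A = {}"
  proof (rule ccontr)
    assume "A \<noteq> {}"
    then obtain i where "i \<in> A" by blast
    then show False
      using uf_familyD(3,4)[OF calculation(1), of i] carE one_integer_mod_group[of 1] by auto
  qed
  ultimately have zero: "K1 ?E = 0" by (simp add: family_cross_def)
  have "K1 (E.H \<alpha>) \<le> (\<Sum>j<\<alpha>. 1 / real p ^ j) + K1 ?E"
  proof -
    interpret H: finite_comm_group "E.H \<alpha>" by (rule E.H_group)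
    obtain B :: "((int \<times> int) \<times> nat) set" where "uf_family (E.H \<alpha>) B fst" "K1 (E.H \<alpha>) = family_cross (E.H \<alpha>) B fst"
      by (rule H.K1_attained)
    then show ?thesis using E.cross_upper_bound[OF wide] by metis
  qed
  moreover have "K1 (integer_mod_group (p ^ \<alpha>)) \<le> K1 (E.H \<alpha>)"
  proof (rule K1_le_if_inj_hom)
    show "finite_comm_group (integer_mod_group (p ^ \<alpha>))"
      using prime_gt_0_nat[OF p] by (intro finite_comm_group_integer_mod_group) simp
    show "(\<lambda>x. (x, 0)) \<in> hom (integer_mod_group (p ^ \<alpha>)) (E.H \<alpha>)"
      unfolding E.H_def by (rule homI) (auto simp: carrier_integer_mod_group)
    show "finite_comm_group (E.H \<alpha>)" by (rule E.H_group)
  qed (auto simp: inj_on_def)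
  ultimately show ?thesis using zero K1_cyclic_ge[OF p, of \<alpha>] by linarith
qed

lemma K1_add_cyclic:
  fixes G :: "('a, 'b) monoid_scheme"
  assumes G: "finite_comm_group G" and wide: "p \<prec>\<^sub>2 group_exponent G"
  shows "K1 (integer_mod_group (p ^ \<alpha>) \<times>\<times> G) = K1 (integer_mod_group (p ^ \<alpha>)) + K1 G"
proof -
  interpret G: finite_comm_group G by fact
  have p: "prime p" "\<not> p dvd group_exponent G" using wide by (auto simp: two_wide_def)
  interpret G: coprime_prime_group G p by unfold_locales (use p in auto)
  interpret H: finite_comm_group "G.H \<alpha>" by (rule G.H_group)
  have "(\<Sum>d | d dvd group_exponent G. 1 / real d) \<le> (real p ^ 2 + 2 * real p - 2) / real p ^ 2"
    using sum_inverse_divisors_le[OF G.group_exponent_pos] wide unfolding two_wide_def by linarith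
  note ub = G.cross_upper_bound[OF this]
  obtain B :: "((int \<times> 'a) \<times> nat) set" where "uf_family (G.H \<alpha>) B fst" "K1 (G.H \<alpha>) = family_cross (G.H \<alpha>) B fst"
    by (rule H.K1_attained)
  then have "K1 (G.H \<alpha>) \<le> K1 (integer_mod_group (p ^ \<alpha>)) + K1 G"
    using ub K1_cyclic_prime_power[OF p(1)] by metis
  moreover have "K1 (integer_mod_group (p ^ \<alpha>)) + K1 G \<le> K1 (G.H \<alpha>)"
    unfolding G.H_def using G prime_gt_0_nat[OF p(1)]
    by (intro K1_DirProd_ge finite_comm_group_integer_mod_group) auto
  ultimately show ?thesis by (simp add: G.H_def)
qed

section \<open>Uniqueness of the invariant of a decomposition\<close>

text \<open>
  These numbers determine the multiset of prime powers in a decomposition into cyclic groups.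
\<close>

definition torsion_count :: "('a, 'b) monoid_scheme \<Rightarrow> nat \<Rightarrow> nat" where
  "torsion_count X m = card {x \<in> carrier X. x [^]\<^bsub>X\<^esub> m = \<one>\<^bsub>X\<^esub>}"

lemma torsion_count_iso:
  assumes G: "group G" and H: "group H" and iso: "G \<cong> H"
  shows "torsion_count G m = torsion_count H m"
proof -
  interpret G: group G by fact
  interpret H: group H by fact
  obtain f where f: "f \<in> hom G H" "bij_betw f (carrier G) (carrier H)"
    using iso by (auto simp: is_iso_def iso_def)
  have pow: "f x [^]\<^bsub>H\<^esub> m = \<one>\<^bsub>H\<^esub> \<longleftrightarrow> x [^]\<^bsub>G\<^esub> m = \<one>\<^bsub>G\<^esub>" if x: "x \<in> carrier G" for x
  proof -
    have "f x [^]\<^bsub>H\<^esub> m = f (x [^]\<^bsub>G\<^esub> m)" by (rule hom_nat_pow[OF f(1) x G H, symmetric])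
    moreover have "f \<one>\<^bsub>G\<^esub> = \<one>\<^bsub>H\<^esub>" by (rule hom_one[OF f(1) G H])
    moreover have "inj_on f (carrier G)" using f(2) bij_betw_def by blast
    ultimately show ?thesis using x by (metis G.nat_pow_closed G.one_closed inj_onD)
  qed
  have "bij_betw f {x \<in> carrier G. x [^]\<^bsub>G\<^esub> m = \<one>\<^bsub>G\<^esub>} {y \<in> carrier H. y [^]\<^bsub>H\<^esub> m = \<one>\<^bsub>H\<^esub>}"
    unfolding bij_betw_def
  proof
    show "inj_on f {x \<in> carrier G. x [^]\<^bsub>G\<^esub> m = \<one>\<^bsub>G\<^esub>}"
      using f(2) by (auto simp: bij_betw_def inj_on_def)
    have im: "f ` carrier G = carrier H" using f(2) by (simp add: bij_betw_def)
    show "f ` {x \<in> carrier G. x [^]\<^bsub>G\<^esub> m = \<one>\<^bsub>G\<^esub>} = {y \<in> carrier H. y [^]\<^bsub>H\<^esub> m = \<one>\<^bsub>H\<^esub>}"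
    proof (intro equalityI subsetI)
      fix y assume y: "y \<in> {y \<in> carrier H. y [^]\<^bsub>H\<^esub> m = \<one>\<^bsub>H\<^esub>}"
      then obtain x where "x \<in> carrier G" "y = f x" using im by auto
      then show "y \<in> f ` {x \<in> carrier G. x [^]\<^bsub>G\<^esub> m = \<one>\<^bsub>G\<^esub>}" using y pow by simp
    qed (use pow im in auto)
  qed
  then show ?thesis unfolding torsion_count_def by (rule bij_betw_same_card)
qed

lemma torsion_count_cyclic:
  assumes n: "n > 0"
  shows "torsion_count (integer_mod_group n) m = gcd m n"
proof -
  define d where "d = n div gcd m n"
  have d: "n = gcd m n * d" by (simp add: d_def)
  with n have d0: "d > 0" by (metis gr0I mult_0_right)
  have iff: "int m * x mod int n = 0 \<longleftrightarrow> int d dvd x" for x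
  proof -
    obtain m' where m': "m = m' * gcd m n" "coprime m' d"
      using n gcd_coprime_exists[of m n] by (metis d_def gcd_nat.neutr_eq_iff nonzero_mult_div_cancel_right not_less0)
    have g0: "gcd m n \<noteq> 0" using n by simp
    have "int m * x mod int n = 0 \<longleftrightarrow> int n dvd int m * x" by (simp add: dvd_eq_mod_eq_0)
    also have "\<dots> \<longleftrightarrow> int (gcd m n) * int d dvd int (gcd m n) * (int m' * x)"
      using m'(1) d by (metis mult.assoc mult.commute of_nat_mult)
    also have "\<dots> \<longleftrightarrow> int d dvd int m' * x" using n by simp
    also have "\<dots> \<longleftrightarrow> int d dvd x"
      using m'(2) by (intro coprime_dvd_mult_right_iff) (simp add: coprime_commute)
    finally show ?thesis .
  qed
  have "{x \<in> carrier (integer_mod_group n). x [^]\<^bsub>integer_mod_group n\<^esub> m = \<one>\<^bsub>integer_mod_group n\<^esub>}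
      = (\<lambda>k. int d * int k) ` {..<gcd m n}"
  proof (intro equalityI subsetI)
    fix x assume "x \<in> {x \<in> carrier (integer_mod_group n). x [^]\<^bsub>integer_mod_group n\<^esub> m = \<one>\<^bsub>integer_mod_group n\<^esub>}"
    then have x: "0 \<le> x" "x < int n" "int d dvd x" using n iff by (auto simp: carrier_integer_mod_group)
    then obtain k where k: "x = int d * k" by (elim dvdE)
    have "0 \<le> k" using k x(1) d0 by (simp add: zero_le_mult_iff)
    moreover have "int d * k < int d * int (gcd m n)"
      using x(2) d unfolding k by (metis mult.commute of_nat_mult)
    then have "k < int (gcd m n)" using d0 by simp
    ultimately show "x \<in> (\<lambda>k. int d * int k) ` {..<gcd m n}"
      unfolding k by (intro image_eqI[of _ _ "nat k"]) auto
  next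
    fix x assume "x \<in> (\<lambda>k. int d * int k) ` {..<gcd m n}"
    then obtain k where k: "x = int d * int k" "k < gcd m n" by auto
    have "d * k < d * gcd m n" using k(2) d0 by simp
    then have "d * k < n" using d by (metis mult.commute)
    then have "int d * int k < int n" by (metis of_nat_less_iff of_nat_mult)
    then show "x \<in> {x \<in> carrier (integer_mod_group n). x [^]\<^bsub>integer_mod_group n\<^esub> m = \<one>\<^bsub>integer_mod_group n\<^esub>}"
      using k iff[of x] n by (simp add: carrier_integer_mod_group)
  qed
  then show ?thesis unfolding torsion_count_def using d0 by (simp add: card_image inj_on_def)
qed

lemma pow_product_group:
  assumes "x \<in> carrier (product_group I A)"
  shows "x [^]\<^bsub>product_group I A\<^esub> (n::nat) = (\<lambda>i\<in>I. x i [^]\<^bsub>A i\<^esub> n)"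
proof (induction n)
  case 0
  show ?case by (simp add: nat_pow_def)
next
  case (Suc n)
  then show ?case by (auto simp: nat_pow_def restrict_def)
qed

lemma torsion_count_product:
  assumes "finite I"
  shows "torsion_count (product_group I A) m = (\<Prod>i\<in>I. torsion_count (A i) m)"
proof -
  have "{x \<in> carrier (product_group I A). x [^]\<^bsub>product_group I A\<^esub> m = \<one>\<^bsub>product_group I A\<^esub>}
     = PiE I (\<lambda>i. {x \<in> carrier (A i). x [^]\<^bsub>A i\<^esub> m = \<one>\<^bsub>A i\<^esub>})"
  proof (intro equalityI subsetI)
    fix x assume x: "x \<in> {x \<in> carrier (product_group I A). x [^]\<^bsub>product_group I A\<^esub> m = \<one>\<^bsub>product_group I A\<^esub>}"
    then have "(\<lambda>i\<in>I. x i [^]\<^bsub>A i\<^esub> m) = (\<lambda>i\<in>I. \<one>\<^bsub>A i\<^esub>)" using pow_product_group[of x I A m] by auto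
    then have "(\<lambda>i\<in>I. x i [^]\<^bsub>A i\<^esub> m) i = (\<lambda>i\<in>I. \<one>\<^bsub>A i\<^esub>) i" for i by (rule fun_cong)
    then have "x i [^]\<^bsub>A i\<^esub> m = \<one>\<^bsub>A i\<^esub>" if "i \<in> I" for i
      using that by (metis (no_types, lifting) restrict_apply')
    then show "x \<in> PiE I (\<lambda>i. {x \<in> carrier (A i). x [^]\<^bsub>A i\<^esub> m = \<one>\<^bsub>A i\<^esub>})" using x by (auto simp: PiE_iff)
  next
    fix x assume x: "x \<in> PiE I (\<lambda>i. {x \<in> carrier (A i). x [^]\<^bsub>A i\<^esub> m = \<one>\<^bsub>A i\<^esub>})"
    then have c: "x \<in> carrier (product_group I A)" by (auto simp: PiE_iff)
    have "(\<lambda>i\<in>I. x i [^]\<^bsub>A i\<^esub> m) = (\<lambda>i\<in>I. \<one>\<^bsub>A i\<^esub>)" using x by (intro restrict_ext) (auto simp: PiE_iff)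
    then show "x \<in> {x \<in> carrier (product_group I A). x [^]\<^bsub>product_group I A\<^esub> m = \<one>\<^bsub>product_group I A\<^esub>}"
      using c pow_product_group[OF c] by auto
  qed
  then show ?thesis unfolding torsion_count_def using assms by (simp add: card_PiE)
qed

definition cyclic_cross :: "nat \<Rightarrow> nat \<Rightarrow> real" where
  "cyclic_cross p a = (real p ^ a - 1) / (real p ^ a - real p ^ (a - 1))"

lemma cyclic_cross_eq_sum:
  assumes "p > 1" "a \<ge> 1"
  shows "cyclic_cross p a = (\<Sum>j<a. 1 / real p ^ j)"
proof -
  obtain b where b: "a = Suc b" using assms(2) by (cases a) auto
  have "(\<Sum>j<a. 1 / real p ^ j) = (\<Sum>j<a. (1 / real p) ^ j)" by (simp add: power_one_over)
  also have "\<dots> = (1 - (1 / real p) ^ a) / (1 - 1 / real p)"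
    using assms(1) sum_gp_strict[of "1 / real p" a] by simp
  also have "\<dots> = cyclic_cross p a"
    unfolding cyclic_cross_def b using assms(1) by (simp add: field_simps power_one_over)
  finally show ?thesis by simp
qed

text \<open>
  In a decomposition, the number of \<open>q ^ l\<close>-torsion elements is the product of \<open>q ^ min l (\<alpha> i)\<close> over
  the summands with \<open>p i = q\<close>. The logarithm of the quotient of two consecutive counts therefore tells
  how many of these summands have \<open>l < \<alpha> i\<close>, and each of them contributes \<open>1 / q ^ l\<close>. The resulting
  expression depends on the group alone; the set \<open>Q\<close> and the bound \<open>M\<close> can be chosen to serve two
  decompositions at once.
\<close>

lemma decomposition_value_eq:
  fixes X :: "('a, 'b) monoid_scheme"
  assumes X: "group X" and dec: "prime_power_decomposition X r p \<alpha>"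
    and Q: "finite Q" "\<And>q. q \<in> Q \<Longrightarrow> prime q" "\<And>i. i < r \<Longrightarrow> p i \<in> Q"
    and M: "\<And>i. i < r \<Longrightarrow> \<alpha> i \<le> M"
  shows "(\<Sum>i<r. cyclic_cross (p i) (\<alpha> i)) =
    (\<Sum>q\<in>Q. \<Sum>l<M. (ln (torsion_count X (q ^ Suc l)) - ln (torsion_count X (q ^ l))) / (ln q * real q ^ l))"
proof -
  have pr: "prime (p i)" "\<alpha> i \<ge> 1" if "i < r" for i using dec that by (auto simp: prime_power_decomposition_def)
  have iso: "X \<cong> product_group {..<r} (\<lambda>i. integer_mod_group (p i ^ \<alpha> i))"
    using dec by (simp add: prime_power_decomposition_def)
  have count: "ln (torsion_count X (q ^ l)) = (\<Sum>i<r. if p i = q then real (min l (\<alpha> i)) * ln q else 0)"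
    if q: "prime q" for q l
  proof -
    have "torsion_count X (q ^ l) = (\<Prod>i<r. torsion_count (integer_mod_group (p i ^ \<alpha> i)) (q ^ l))"
      by (subst torsion_count_iso[OF X _ iso]) (auto intro!: torsion_count_product)
    also have "\<dots> = (\<Prod>i<r. gcd (q ^ l) (p i ^ \<alpha> i))"
      using pr prime_gt_0_nat by (intro prod.cong torsion_count_cyclic) auto
    also have "\<dots> = (\<Prod>i<r. if p i = q then q ^ min l (\<alpha> i) else 1)"
    proof (intro prod.cong refl)
      fix i assume "i \<in> {..<r}"
      then have pi: "prime (p i)" using pr by simp
      show "gcd (q ^ l) (p i ^ \<alpha> i) = (if p i = q then q ^ min l (\<alpha> i) else 1)"
      proof (cases "p i = q")
        case True
        show ?thesis
        proof (cases "l \<le> \<alpha> i")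
          case True
          then have "q ^ l dvd q ^ \<alpha> i" by (rule le_imp_power_dvd)
          then show ?thesis using True \<open>p i = q\<close> by (simp add: min_def gcd_proj1_iff)
        next
          case False
          then have "q ^ \<alpha> i dvd q ^ l" by (intro le_imp_power_dvd) simp
          then show ?thesis using False \<open>p i = q\<close> by (simp add: min_def gcd_proj2_iff)
        qed
      next
        case False
        then have "coprime q (p i)" using pi q primes_coprime by blast
        then show ?thesis using False by simp
      qed
    qed
    finally have "ln (real (torsion_count X (q ^ l))) = ln (\<Prod>i<r. if p i = q then real q ^ min l (\<alpha> i) else 1)"
      by (simp add: if_distrib cong: if_cong)
    also have "\<dots> = (\<Sum>i<r. ln (if p i = q then real q ^ min l (\<alpha> i) else 1))"
      using prime_gt_0_nat[OF q] by (intro ln_prod) auto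
    also have "\<dots> = (\<Sum>i<r. if p i = q then real (min l (\<alpha> i)) * ln q else 0)"
      using prime_gt_0_nat[OF q] by (intro sum.cong) (auto simp: ln_realpow)
    finally show ?thesis .
  qed
  have "(\<Sum>q\<in>Q. \<Sum>l<M. (ln (torsion_count X (q ^ Suc l)) - ln (torsion_count X (q ^ l))) / (ln q * real q ^ l))
     = (\<Sum>q\<in>Q. \<Sum>l<M. \<Sum>i<r. if p i = q \<and> l < \<alpha> i then 1 / real q ^ l else 0)"
  proof (intro sum.cong refl)
    fix q l assume "q \<in> Q"
    then have q: "prime q" using Q by blast
    have lnq: "ln (real q) \<noteq> 0" using prime_gt_1_nat[OF q] by simp
    have "ln (torsion_count X (q ^ Suc l)) - ln (torsion_count X (q ^ l))
       = (\<Sum>i<r. if p i = q \<and> l < \<alpha> i then ln q else 0)"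
      unfolding count[OF q] sum_subtractf[symmetric]
      by (intro sum.cong) (auto simp: min_def algebra_simps)
    then show "(ln (torsion_count X (q ^ Suc l)) - ln (torsion_count X (q ^ l))) / (ln q * real q ^ l)
       = (\<Sum>i<r. if p i = q \<and> l < \<alpha> i then 1 / real q ^ l else 0)"
      using lnq by (simp add: sum_divide_distrib if_distrib[of "\<lambda>x. x / _"] cong: if_cong)
  qed
  also have "\<dots> = (\<Sum>i<r. \<Sum>q\<in>Q. \<Sum>l<M. if p i = q \<and> l < \<alpha> i then 1 / real q ^ l else 0)"
    by (simp only: sum.swap[of _ "{..<r}"])
  also have "\<dots> = (\<Sum>i<r. cyclic_cross (p i) (\<alpha> i))"
  proof (intro sum.cong refl)
    fix i assume "i \<in> {..<r}"
    then have i: "i < r" by simp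
    have "(\<Sum>q\<in>Q. \<Sum>l<M. if p i = q \<and> l < \<alpha> i then 1 / real q ^ l else 0)
       = (\<Sum>q\<in>Q. if p i = q then (\<Sum>l<M. if l < \<alpha> i then 1 / real q ^ l else 0) else 0)"
      by (intro sum.cong) auto
    also have "\<dots> = (\<Sum>l<M. if l < \<alpha> i then 1 / real (p i) ^ l else 0)"
      using Q(1) Q(3)[OF i] by simp
    also have "\<dots> = (\<Sum>l<\<alpha> i. 1 / real (p i) ^ l)"
      using M[OF i] by (intro sum.mono_neutral_cong_right) auto
    also have "\<dots> = cyclic_cross (p i) (\<alpha> i)"
      using cyclic_cross_eq_sum[OF prime_gt_1_nat[OF pr(1)[OF i]] pr(2)[OF i]] by simp
    finally show "(\<Sum>q\<in>Q. \<Sum>l<M. if p i = q \<and> l < \<alpha> i then 1 / real q ^ l else 0) = cyclic_cross (p i) (\<alpha> i)" .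
  qed
  finally show ?thesis by simp
qed

lemma K1_star_eq:
  fixes X :: "('a, 'b) monoid_scheme"
  assumes X: "group X" and dec: "prime_power_decomposition X r p \<alpha>"
  shows "K1_star X = (\<Sum>i<r. cyclic_cross (p i) (\<alpha> i))"
  unfolding K1_star_def cyclic_cross_def[symmetric]
proof (rule the_equality)
  show "\<exists>r' p' \<alpha>'. prime_power_decomposition X r' p' \<alpha>' \<and>
      (\<Sum>i<r. cyclic_cross (p i) (\<alpha> i)) = (\<Sum>i<r'. cyclic_cross (p' i) (\<alpha>' i))"
    using dec by blast
next
  fix x assume "\<exists>r p \<alpha>. prime_power_decomposition X r p \<alpha> \<and> x = (\<Sum>i<r. cyclic_cross (p i) (\<alpha> i))"
  then obtain r' p' \<alpha>' where dec': "prime_power_decomposition X r' p' \<alpha>'"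
    and x: "x = (\<Sum>i<r'. cyclic_cross (p' i) (\<alpha>' i))" by blast
  define Q where "Q = p ` {..<r} \<union> p' ` {..<r'}"
  \<comment> \<open>Any common bound on the exponents will do.\<close>
  define M where "M = (\<Sum>i<r. \<alpha> i) + (\<Sum>i<r'. \<alpha>' i)"
  have Q: "finite Q" "\<And>q. q \<in> Q \<Longrightarrow> prime q"
    using dec dec' by (auto simp: Q_def prime_power_decomposition_def)
  have M: "\<alpha> i \<le> M" if "i < r" for i
    using that member_le_sum[of i "{..<r}" \<alpha>] by (simp add: M_def)
  have M': "\<alpha>' i \<le> M" if "i < r'" for i
    using that member_le_sum[of i "{..<r'}" \<alpha>'] by (simp add: M_def)
  show "x = (\<Sum>i<r. cyclic_cross (p i) (\<alpha> i))"
    unfolding x using decomposition_value_eq[OF X dec Q _ M] decomposition_value_eq[OF X dec' Q _ M']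
    by (simp add: Q_def)
qed

lemma decomposition_cong_iso:
  assumes "X \<cong> Y" "prime_power_decomposition Y r p \<alpha>"
  shows "prime_power_decomposition X r p \<alpha>"
  using assms iso_trans unfolding prime_power_decomposition_def by blast

lemma decomposition_add_cyclic:
  assumes G: "group G" and dec: "prime_power_decomposition G r p \<alpha>" and q: "prime q" "a \<ge> 1"
  shows "prime_power_decomposition (integer_mod_group (q ^ a) \<times>\<times> G) (Suc r) (p(r := q)) (\<alpha>(r := a))"
proof -
  let ?Z = "integer_mod_group (q ^ a)"
  let ?A = "\<lambda>i. integer_mod_group (p i ^ \<alpha> i)"
  let ?B = "\<lambda>i. integer_mod_group ((p(r := q)) i ^ (\<alpha>(r := a)) i)"
  let ?P = "product_group {..<r} ?A" and ?P' = "product_group {..<Suc r} ?B"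
  define f where "f = (\<lambda>(x, h). \<lambda>i\<in>{..<Suc r}. if i = r then x else h i :: int)"
  have "f \<in> iso (?Z \<times>\<times> ?P) ?P'"
    unfolding iso_def
  proof (intro CollectI conjI)
    show hom: "f \<in> hom (?Z \<times>\<times> ?P) ?P'"
    proof (rule homI)
      fix x assume "x \<in> carrier (?Z \<times>\<times> ?P)"
      then obtain x1 x2 where e: "x = (x1, x2)" and x1: "x1 \<in> carrier ?Z"
        and x2: "\<And>i. i < r \<Longrightarrow> x2 i \<in> carrier (?A i)" by (auto simp: PiE_iff)
      have "f x i \<in> carrier (?B i)" if "i < Suc r" for i
      proof (cases "i = r")
        case False
        then show ?thesis using x2[of i] that by (simp add: e f_def)
      qed (use x1 in \<open>simp add: e f_def\<close>)
      moreover have "f x \<in> extensional {..<Suc r}" by (simp add: e f_def)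
      ultimately show "f x \<in> carrier ?P'" by (simp only: carrier_product_group PiE_iff) simp
    next
      fix x y :: "int \<times> (nat \<Rightarrow> int)"
      obtain x1 x2 y1 y2 where e: "x = (x1, x2)" "y = (y1, y2)" by (metis surj_pair)
      show "f (x \<otimes>\<^bsub>?Z \<times>\<times> ?P\<^esub> y) = f x \<otimes>\<^bsub>?P'\<^esub> f y"
      proof
        fix i
        show "f (x \<otimes>\<^bsub>?Z \<times>\<times> ?P\<^esub> y) i = (f x \<otimes>\<^bsub>?P'\<^esub> f y) i"
          by (cases "i < r"; cases "i = r") (simp_all add: e f_def)
      qed
    qed
    show "bij_betw f (carrier (?Z \<times>\<times> ?P)) (carrier ?P')"
    proof (rule bij_betw_byWitness[where f' = "\<lambda>g. (g r, restrict g {..<r})"])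
      show "\<forall>x\<in>carrier (?Z \<times>\<times> ?P). (f x r, restrict (f x) {..<r}) = x"
      proof
        fix x assume "x \<in> carrier (?Z \<times>\<times> ?P)"
        then obtain x1 x2 where e: "x = (x1, x2)" and x2: "x2 \<in> extensional {..<r}"
          by (auto simp: PiE_iff)
        have "restrict (f x) {..<r} i = x2 i" for i
          using extensional_arb[OF x2, of i] by (cases "i < r") (simp_all add: e f_def)
        then show "(f x r, restrict (f x) {..<r}) = x" by (auto simp: e f_def)
      qed
      show "\<forall>g\<in>carrier ?P'. f (g r, restrict g {..<r}) = g"
      proof
        fix g assume "g \<in> carrier ?P'"
        then have g: "g \<in> extensional {..<Suc r}" by (auto simp: PiE_iff)
        show "f (g r, restrict g {..<r}) = g"
        proof
          fix i
          show "f (g r, restrict g {..<r}) i = g i"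
            using extensional_arb[OF g, of i] by (simp add: f_def less_Suc_eq)
        qed
      qed
      show "f ` carrier (?Z \<times>\<times> ?P) \<subseteq> carrier ?P'" using hom_carrier[OF hom] .
      show "(\<lambda>g. (g r, restrict g {..<r})) ` carrier ?P' \<subseteq> carrier (?Z \<times>\<times> ?P)"
      proof
        fix x assume "x \<in> (\<lambda>g. (g r, restrict g {..<r})) ` carrier ?P'"
        then obtain g where e: "x = (g r, restrict g {..<r})"
          and g: "\<And>i. i < Suc r \<Longrightarrow> g i \<in> carrier (?B i)" by (auto simp: PiE_iff)
        have "g i \<in> carrier (?A i)" if "i < r" for i using g[of i] that by simp
        then show "x \<in> carrier (?Z \<times>\<times> ?P)" using g[of r] by (simp add: e)
      qed
    qed
  qed
  moreover obtain g where "g \<in> iso G ?P" using dec by (auto simp: prime_power_decomposition_def is_iso_def)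
  then have "(\<lambda>(x, y). (x, g y)) \<in> iso (?Z \<times>\<times> G) (?Z \<times>\<times> ?P)"
    using iso_paired2[of ?Z G "\<lambda>x. x" g ?Z ?P] G iso_set_refl by auto
  ultimately have "?Z \<times>\<times> G \<cong> ?P'" using iso_set_trans unfolding is_iso_def by blast
  then show ?thesis using dec q by (auto simp: prime_power_decomposition_def less_Suc_eq)
qed

lemma decomposition_trivial:
  assumes "group G" "carrier G = {\<one>\<^bsub>G\<^esub>}"
  shows "prime_power_decomposition G 0 p \<alpha>"
proof -
  interpret group G by fact
  have "(\<lambda>x. \<lambda>i\<in>{}. undefined) \<in> iso G (product_group {..<0::nat} (\<lambda>i. integer_mod_group (p i ^ \<alpha> i)))"
    using assms(2) by (auto simp: iso_def hom_def bij_betw_def)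
  then show ?thesis by (auto simp: prime_power_decomposition_def is_iso_def)
qed

section \<open>Decomposition into cyclic groups\<close>

context finite_comm_group
begin

text \<open>
  By Bezout, \<open>x\<close> is a product of powers of the two given powers.
\<close>

lemma subgroup_coprime_pow:
  assumes S: "subgroup S G" and x: "x \<in> carrier G" and u: "x [^] (u::int) \<in> S" and v: "x [^] (v::int) \<in> S"
    and cop: "coprime u v"
  shows "x \<in> S"
proof -
  obtain a b where ab: "a * u + b * v = 1" using cop bezout_int[of u v] by (auto simp: coprime_iff_gcd_eq_1)
  have "x [^] (u * a) \<in> S" "x [^] (v * b) \<in> S"
    using subgroup_int_pow_closed[OF S u, of a] subgroup_int_pow_closed[OF S v, of b] x
    by (simp_all add: int_pow_pow)
  then have "x [^] (u * a) \<otimes> x [^] (v * b) \<in> S" by (rule subgroup.m_closed[OF S])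
  moreover have "x [^] (u * a) \<otimes> x [^] (v * b) = x [^] (1::int)"
    using x ab by (simp add: int_pow_mult[symmetric] mult.commute)
  ultimately show ?thesis using x by simp
qed

text \<open>
  An element \<open>a\<close> of maximal \<open>q\<close>-power order generates a direct summand. Take a subgroup \<open>K\<close> maximal
  among those meeting \<open>\<langle>a\<rangle>\<close> trivially and suppose \<open>S = \<langle>a\<rangle>K\<close> is not everything. Some \<open>b\<close> outside \<open>S\<close> has a
  prime power \<open>b [^] s\<close> inside, say \<open>a [^] i \<otimes> k\<close>. Maximality of the order of \<open>a\<close> makes \<open>a [^] i\<close> an
  \<open>s\<close>-th power in \<open>\<langle>a\<rangle>\<close>, so \<open>b\<close> can be corrected by a power of \<open>a\<close> to an element \<open>c\<close> outside \<open>S\<close> with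
  \<open>c [^] s\<close> in \<open>K\<close>. But then \<open>K\<langle>c\<rangle>\<close> still meets \<open>\<langle>a\<rangle>\<close> trivially, against the choice of \<open>K\<close>.
\<close>

lemma cyclic_summand_complement:
  assumes q: "prime q" and a: "a \<in> carrier G" "ord a = q ^ m" "m \<ge> 1"
    and max: "\<And>x k. x \<in> carrier G \<Longrightarrow> ord x = q ^ k \<Longrightarrow> k \<le> m"
  shows "\<exists>K. subgroup K G \<and> generate G {a} \<inter> K = {\<one>} \<and> generate G {a} <#> K = carrier G"
proof -
  let ?A = "generate G {a}"
  have A: "subgroup ?A G" using a by (intro generate_is_subgroup) auto
  have A_eq: "?A = {a [^] (k::int) | k. True}" using generate_pow[OF a(1)] by auto
  let ?\<K> = "{K. subgroup K G \<and> ?A \<inter> K = {\<one>}}"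
  have "?\<K> \<subseteq> Pow (carrier G)" using subgroup.subset by blast
  then have fK: "finite ?\<K>" using finite_carrier finite_subset by blast
  have "{\<one>} \<in> ?\<K>" using triv_subgroup subgroup.one_closed[OF A] by blast
  then have "?\<K> \<noteq> {}" by (metis (no_types, lifting) empty_iff)
  from finite_has_maximal[OF fK this]
  obtain K where K: "K \<in> ?\<K>" and "\<forall>L\<in>?\<K>. K \<le> L \<longrightarrow> K = L" ..
  then have Kmax: "\<And>L. L \<in> ?\<K> \<Longrightarrow> K \<subseteq> L \<Longrightarrow> K = L" by simp
  have sK: "subgroup K G" and AK1: "?A \<inter> K = {\<one>}" using K by auto
  define S where "S = ?A <#> K"
  have sS: "subgroup S G" unfolding S_def by (rule mult_subgroups[OF A sK])
  have KS: "K \<subseteq> S"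
  proof
    fix k assume k: "k \<in> K"
    then have "\<one> \<otimes> k \<in> S" unfolding S_def set_mult_def using subgroup.one_closed[OF A] by blast
    then show "k \<in> S" using k subgroup.mem_carrier[OF sK] by simp
  qed
  have AS: "?A \<subseteq> S"
  proof
    fix x assume x: "x \<in> ?A"
    then have "x \<otimes> \<one> \<in> S" unfolding S_def set_mult_def using subgroup.one_closed[OF sK] by blast
    then show "x \<in> S" using x subgroup.mem_carrier[OF A] by simp
  qed
  have q1: "q > 1" using q prime_gt_1_nat by blast
  have "S = carrier G"
  proof (rule ccontr)
    assume "S \<noteq> carrier G"
    then obtain b0 where b0: "b0 \<in> carrier G" "b0 \<notin> S" using subgroup.subset[OF sS] by blast
    define n where "n = (LEAST n. n > 0 \<and> b0 [^] (n::nat) \<in> S)"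
    have ex: "ord b0 > 0 \<and> b0 [^] ord b0 \<in> S" using b0 ord_pos subgroup.one_closed[OF sS] by simp
    have n: "n > 0" "b0 [^] n \<in> S" using LeastI[of "\<lambda>n. n > 0 \<and> b0 [^] (n::nat) \<in> S", OF ex] by (auto simp: n_def)
    have least: "\<not> (k > 0 \<and> b0 [^] k \<in> S)" if "k < n" for k :: nat
      using not_less_Least[of k "\<lambda>n. n > 0 \<and> b0 [^] (n::nat) \<in> S"] that by (simp add: n_def)
    have "n \<noteq> 1" using n(2) b0 by auto
    then obtain s where s: "prime s" "s dvd n" using prime_factor_nat by blast
    then obtain n' where n': "n = s * n'" by (elim dvdE)
    have "n' < n" "n' > 0" using n' n(1) prime_gt_1_nat[OF s(1)] by auto
    define b1 where "b1 = b0 [^] n'"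
    have b1: "b1 \<in> carrier G" "b1 \<notin> S" "b1 [^] s \<in> S"
      using b0 least[OF \<open>n' < n\<close>] \<open>n' > 0\<close> n(2) by (auto simp: b1_def nat_pow_pow n' mult.commute)
    \<comment> \<open>For \<open>s = q\<close> the part of order prime to \<open>q\<close> is removed, so that the order of \<open>b\<close> divides \<open>q ^ m\<close>.\<close>
    have "\<exists>b. b \<in> carrier G \<and> b \<notin> S \<and> b [^] s \<in> S \<and> (s = q \<longrightarrow> b [^] (q ^ m) = \<one>)"
    proof (cases "s = q")
      case True
      obtain e t where et: "ord b1 = q ^ e * t" "\<not> q dvd t"
        using ord_pos[OF b1(1)] multiplicity_decompose'[of "ord b1" q] q
        by (metis not_prime_unit neq0_conv)
      have t0: "t \<noteq> 0" using et(2) by (metis dvd_0_right)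
      have "ord (b1 [^] t) = q ^ e" using b1(1) et t0 by (subst ord_pow) auto
      then have "e \<le> m" using max[of "b1 [^] t" e] b1(1) by simp
      then have "ord (b1 [^] t) dvd q ^ m" using \<open>ord (b1 [^] t) = q ^ e\<close> by (simp add: le_imp_power_dvd)
      then have one: "(b1 [^] t) [^] (q ^ m) = \<one>" using b1(1) pow_eq_id nat_pow_closed by blast
      have "b1 [^] t \<notin> S"
      proof
        assume "b1 [^] t \<in> S"
        then have "b1 [^] int t \<in> S" "b1 [^] int s \<in> S" using b1 by (simp_all add: int_pow_int)
        moreover have "coprime (int t) (int s)"
          using et(2) q True by (simp add: coprime_commute prime_imp_coprime)
        ultimately show False using subgroup_coprime_pow[OF sS b1(1)] b1(2) by blast
      qed
      moreover have "(b1 [^] t) [^] s = (b1 [^] s) [^] t" using b1(1) by (simp add: nat_pow_pow mult.commute)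
      then have "(b1 [^] t) [^] s \<in> S"
        using subgroup_int_pow_closed[OF sS b1(3), of "int t"] by (simp add: int_pow_int)
      ultimately show ?thesis using one b1(1) by blast
    qed (use b1 in blast)
    then obtain b where b: "b \<in> carrier G" "b \<notin> S" "b [^] s \<in> S" "s = q \<Longrightarrow> b [^] (q ^ m) = \<one>" by blast
    obtain i k where ik: "b [^] s = a [^] (i::int) \<otimes> k" "k \<in> K"
      using b(3) unfolding S_def set_mult_def A_eq by blast
    have k: "k \<in> carrier G" using ik(2) subgroup.mem_carrier[OF sK] by blast
    have "\<exists>j. a [^] i = a [^] (j * int s)"
    proof (cases "s = q")
      case False
      then have "coprime (int s) (int (q ^ m))" using s(1) q primes_coprime by auto
      then obtain u v where uv: "u * int s + v * int (q ^ m) = 1"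
        using bezout_int[of "int s" "int (q ^ m)"] by (auto simp: coprime_iff_gcd_eq_1)
      have "i * u * int s - i = - i * v * int (q ^ m)" using uv by (simp add: algebra_simps) (metis mult.left_commute distrib_left mult.right_neutral)
      then have "int (ord a) dvd i * u * int s - i" by (simp add: a(2))
      then have "a [^] i = a [^] (i * u * int s)" using int_pow_eq[OF a(1)] by blast
      then show ?thesis by blast
    next
      case True
      obtain m' where m': "m = Suc m'" using a(3) by (cases m) auto
      have "\<one> = (b [^] s) [^] (q ^ m')" using b(1,4) True by (simp add: nat_pow_pow m')
      also have "\<dots> = (a [^] i) [^] (q ^ m') \<otimes> k [^] (q ^ m')"
        unfolding ik(1) using a(1) k by (simp add: nat_pow_distrib)
      finally have e: "(a [^] i) [^] (q ^ m') \<otimes> k [^] (q ^ m') = \<one>" by simp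
      have c1: "(a [^] i) [^] (q ^ m') = a [^] (i * int (q ^ m'))"
        using int_pow_pow[OF a(1), of i "int (q ^ m')"] by (simp only: int_pow_int)
      have "k [^] (q ^ m') \<in> K"
        using subgroup_int_pow_closed[OF sK ik(2), of "int (q ^ m')"] by (simp only: int_pow_int)
      then have "inv (k [^] (q ^ m')) \<in> K" using subgroup.m_inv_closed[OF sK] by blast
      moreover have "a [^] (i * int (q ^ m')) = inv (k [^] (q ^ m'))"
        using e k a(1) unfolding c1 by (metis int_pow_closed inv_equality nat_pow_closed)
      moreover have "a [^] (i * int (q ^ m')) \<in> ?A" unfolding A_eq by blast
      ultimately have "a [^] (i * int (q ^ m')) = \<one>" using AK1 by auto
      then have "int (q ^ m) dvd i * int (q ^ m')" using int_pow_eq_id[OF a(1)] a(2) by metis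
      then have "int q dvd i" using q1 by (simp add: m')
      then obtain j where "i = j * int s" using True by (metis dvdE mult.commute)
      then show ?thesis by blast
    qed
    then obtain j where j: "a [^] i = a [^] (j * int s)" by blast
    define c where "c = b \<otimes> a [^] (- j)"
    have aj: "a [^] j \<in> S" "a [^] (- j) \<in> carrier G" using AS A_eq a(1) by auto
    have c: "c \<in> carrier G" using b(1) a(1) by (simp add: c_def)
    have "c [^] s = b [^] s \<otimes> a [^] (- j * int s)"
      using b(1) a(1) int_pow_pow[OF a(1), of "- j" "int s"] by (simp add: c_def nat_pow_distrib int_pow_int)
    also have "\<dots> = k \<otimes> (a [^] (j * int s) \<otimes> a [^] (- j * int s))"
      unfolding ik(1) j using k a(1) by (simp add: m_ac)
    also have "\<dots> = k" using k a(1) by (simp add: int_pow_mult[symmetric])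
    finally have cs: "c [^] s \<in> K" using ik(2) by simp
    have cS: "c \<notin> S"
    proof
      assume "c \<in> S"
      then have "c \<otimes> a [^] j \<in> S" using aj(1) by (rule subgroup.m_closed[OF sS])
      moreover have "c \<otimes> a [^] j = b"
        using b(1) a(1) by (simp add: c_def m_assoc int_pow_mult[symmetric])
      ultimately show False using b by simp
    qed
    have sC: "subgroup (generate G {c}) G" using c by (intro generate_is_subgroup) auto
    have sL: "subgroup (K <#> generate G {c}) G" by (rule mult_subgroups[OF sK sC])
    have KL: "K \<subseteq> K <#> generate G {c}"
    proof
      fix x assume x: "x \<in> K"
      then have "x \<otimes> \<one> \<in> K <#> generate G {c}"
        unfolding set_mult_def using subgroup.one_closed[OF sC] by blast
      then show "x \<in> K <#> generate G {c}" using x subgroup.mem_carrier[OF sK] by simp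
    qed
    have "\<one> \<otimes> c \<in> K <#> generate G {c}"
      unfolding set_mult_def using subgroup.one_closed[OF sK] generate.incl[of c "{c}" G] by blast
    then have cL: "c \<in> K <#> generate G {c}" using c by simp
    have "?A \<inter> (K <#> generate G {c}) \<noteq> {\<one>}"
      using Kmax[of "K <#> generate G {c}"] sL KL cL cS KS by blast
    moreover have "\<one> \<in> ?A \<inter> (K <#> generate G {c})"
      using subgroup.one_closed[OF A] subgroup.one_closed[OF sL] by blast
    ultimately obtain z where z: "z \<in> ?A" "z \<in> K <#> generate G {c}" "z \<noteq> \<one>" by blast
    then obtain k' l where kl: "k' \<in> K" "z = k' \<otimes> c [^] (l::int)"
      unfolding set_mult_def generate_pow[OF c] by blast
    have k': "k' \<in> carrier G" using kl(1) subgroup.mem_carrier[OF sK] by blast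
    show False
    proof (cases "int s dvd l")
      case True
      then obtain w where w: "l = int s * w" by (elim dvdE)
      have "c [^] l = (c [^] s) [^] w" using int_pow_pow[OF c, of "int s" w] by (simp add: w int_pow_int)
      then have "c [^] l \<in> K" using subgroup_int_pow_closed[OF sK cs] by simp
      then have "z \<in> K" using kl subgroup.m_closed[OF sK] by simp
      then show False using z AK1 by blast
    next
      case False
      have "inv k' \<otimes> z \<in> S"
        using kl(1) KS z(1) AS subgroup.m_closed[OF sS] subgroup.m_inv_closed[OF sS] by blast
      moreover have "inv k' \<otimes> z = c [^] l" using kl(2) k' c by (simp add: m_assoc[symmetric])
      ultimately have "c [^] l \<in> S" by simp
      moreover have "c [^] int s \<in> S" using cs KS by (auto simp: int_pow_int)
      moreover have "coprime l (int s)"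
        using prime_imp_coprime[of "int s" l] False s(1) by (simp add: coprime_commute)
      ultimately show False using subgroup_coprime_pow[OF sS c] cS by blast
    qed
  qed
  then show ?thesis using sK AK1 S_def by blast
qed

lemma cyclic_summand:
  assumes nontriv: "carrier G \<noteq> {\<one>}"
  obtains q m K where "prime q" "m \<ge> 1" "subgroup K G" "card K < card (carrier G)"
    "integer_mod_group (q ^ m) \<times>\<times> G\<lparr>carrier := K\<rparr> \<cong> G"
proof -
  obtain b where b: "b \<in> carrier G" "b \<noteq> \<one>" using nontriv one_closed by blast
  then have "ord b \<noteq> 1" using ord_eq_1 by blast
  then obtain q where q: "prime q" "q dvd ord b" using prime_factor_nat by blast
  have q1: "q > 1" using q prime_gt_1_nat by blast
  define E where "E = {k. \<exists>x\<in>carrier G. ord x = q ^ k}"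
  have "E \<subseteq> {..Max (ord ` carrier G)}"
  proof
    fix k assume "k \<in> E"
    then obtain x where x: "x \<in> carrier G" "ord x = q ^ k" by (auto simp: E_def)
    have "k < q ^ k" using q1 by (simp add: power_gt_expt)
    also have "\<dots> \<le> Max (ord ` carrier G)" using x finite_carrier by (metis Max_ge finite_imageI imageI)
    finally show "k \<in> {..Max (ord ` carrier G)}" by simp
  qed
  then have fE: "finite E" using finite_subset by blast
  have "ord (b [^] (ord b div q)) = q"
  proof -
    have d: "ord b div q dvd ord b" "ord b div q \<noteq> 0" using q ord_pos[OF b(1)] by (auto elim!: dvdE)
    have "ord b div (ord b div q) = q" using q ord_pos[OF b(1)] by (auto elim!: dvdE)
    then show ?thesis using ord_pow[OF b(1) d] by simp
  qed
  then have "1 \<in> E" using b(1) by (auto simp: E_def)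
  define m where "m = Max E"
  have m: "m \<in> E" "m \<ge> 1" "\<And>k. k \<in> E \<Longrightarrow> k \<le> m"
    using fE \<open>1 \<in> E\<close> by (auto simp: m_def intro: Max_in Max_ge)
  then obtain a where a: "a \<in> carrier G" "ord a = q ^ m" by (auto simp: E_def)
  obtain K where K: "subgroup K G" "generate G {a} \<inter> K = {\<one>}" "generate G {a} <#> K = carrier G"
    using cyclic_summand_complement[OF q(1) a m(2)] m(3) by (auto simp: E_def)
  have Kc: "K \<subseteq> carrier G" using K(1) subgroup.subset by blast
  have "a \<noteq> \<one>" using a m(2) q1 ord_id by (metis less_not_refl2 one_less_power zero_less_one order_less_le_trans)
  then have "a \<notin> K" using K(2) generate.incl[of a "{a}" G] by blast
  then have "card K < card (carrier G)" using Kc a(1) finite_carrier by (intro psubset_card_mono) auto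
  moreover have "integer_mod_group (q ^ m) \<times>\<times> G\<lparr>carrier := K\<rparr> \<cong> G"
  proof -
    define f where "f = (\<lambda>(x::int, k). a [^] x \<otimes> k)"
    have qm: "q ^ m > 0" using q1 by simp
    have car: "carrier (integer_mod_group (q ^ m)) = {0..<int (q ^ m)}"
      using qm unfolding carrier_integer_mod_group by (metis less_not_refl)
    have modpow: "a [^] (x mod int (q ^ m)) = a [^] x" for x
    proof -
      have "int (ord a) dvd x - x mod int (q ^ m)" unfolding a(2) by (rule dvd_minus_mod)
      then show ?thesis using int_pow_eq[OF a(1)] by blast
    qed
    have hom: "f \<in> hom (integer_mod_group (q ^ m) \<times>\<times> G\<lparr>carrier := K\<rparr>) G"
    proof (rule homI)
      fix x assume "x \<in> carrier (integer_mod_group (q ^ m) \<times>\<times> G\<lparr>carrier := K\<rparr>)"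
      then show "f x \<in> carrier G" using a(1) Kc by (auto simp: f_def)
    next
      fix x y assume xy: "x \<in> carrier (integer_mod_group (q ^ m) \<times>\<times> G\<lparr>carrier := K\<rparr>)"
        "y \<in> carrier (integer_mod_group (q ^ m) \<times>\<times> G\<lparr>carrier := K\<rparr>)"
      obtain x1 x2 y1 y2 where e: "x = (x1, x2)" "y = (y1, y2)" by (metis surj_pair)
      have "x2 \<in> carrier G" "y2 \<in> carrier G" using xy Kc by (auto simp: e)
      then show "f (x \<otimes>\<^bsub>integer_mod_group (q ^ m) \<times>\<times> G\<lparr>carrier := K\<rparr>\<^esub> y) = f x \<otimes> f y"
        using modpow[of "x1 + y1"] a(1) by (simp add: e f_def int_pow_mult m_ac del: of_nat_power)
    qed
    have inj: "inj_on f (carrier (integer_mod_group (q ^ m) \<times>\<times> G\<lparr>carrier := K\<rparr>))"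
    proof (rule inj_onI)
      fix x y assume xy: "x \<in> carrier (integer_mod_group (q ^ m) \<times>\<times> G\<lparr>carrier := K\<rparr>)"
        "y \<in> carrier (integer_mod_group (q ^ m) \<times>\<times> G\<lparr>carrier := K\<rparr>)" "f x = f y"
      obtain x1 x2 y1 y2 where e: "x = (x1, x2)" "y = (y1, y2)" by (metis surj_pair)
      have K2: "x2 \<in> K" "y2 \<in> K" using xy by (auto simp: e)
      have r: "0 \<le> x1" "x1 < int (q ^ m)" "0 \<le> y1" "y1 < int (q ^ m)" using xy unfolding e by (simp_all add: car)
      have eq: "a [^] x1 \<otimes> x2 = a [^] y1 \<otimes> y2" using xy(3) by (simp add: e f_def)
      have c: "x2 \<in> carrier G" "y2 \<in> carrier G" "a [^] x1 \<in> carrier G" "a [^] y1 \<in> carrier G"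
        using K2 Kc a(1) by auto
      have "a [^] (x1 - y1) = inv (a [^] y1) \<otimes> a [^] x1"
        using a(1) c by (simp add: int_pow_diff m_comm)
      also have "a [^] x1 = a [^] y1 \<otimes> y2 \<otimes> inv x2" using eq c by (metis inv_solve_right m_closed)
      also have "inv (a [^] y1) \<otimes> (a [^] y1 \<otimes> y2 \<otimes> inv x2) = y2 \<otimes> inv x2"
        using c by (simp add: m_assoc[symmetric])
      finally have d: "a [^] (x1 - y1) = y2 \<otimes> inv x2" .
      have "y2 \<otimes> inv x2 \<in> K" using K2 subgroup.m_closed[OF K(1)] subgroup.m_inv_closed[OF K(1)] by blast
      moreover have "a [^] (x1 - y1) \<in> generate G {a}" using generate_pow[OF a(1)] by blast
      ultimately have one: "a [^] (x1 - y1) = \<one>" using d K(2) by auto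
      then have "int (q ^ m) dvd x1 - y1" using int_pow_eq_id[OF a(1)] a(2) by metis
      then have "x1 mod int (q ^ m) = y1 mod int (q ^ m)" by (simp add: mod_eq_dvd_iff)
      then have x1: "x1 = y1" using r by simp
      then have "x2 = y2" using eq c by simp
      then show "x = y" using x1 e by simp
    qed
    have surj: "f ` carrier (integer_mod_group (q ^ m) \<times>\<times> G\<lparr>carrier := K\<rparr>) = carrier G"
    proof
      show "f ` carrier (integer_mod_group (q ^ m) \<times>\<times> G\<lparr>carrier := K\<rparr>) \<subseteq> carrier G"
        using hom_carrier[OF hom] .
      show "carrier G \<subseteq> f ` carrier (integer_mod_group (q ^ m) \<times>\<times> G\<lparr>carrier := K\<rparr>)"
      proof
        fix g assume "g \<in> carrier G"
        then obtain i k where ik: "k \<in> K" "g = a [^] (i::int) \<otimes> k"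
          unfolding K(3)[symmetric] set_mult_def generate_pow[OF a(1)] by blast
        have "f (i mod int (q ^ m), k) = g" unfolding f_def prod.case modpow ik(2) ..
        moreover have "i mod int (q ^ m) \<in> {0..<int (q ^ m)}" using qm by simp
        ultimately show "g \<in> f ` carrier (integer_mod_group (q ^ m) \<times>\<times> G\<lparr>carrier := K\<rparr>)"
          using ik(1) car by (intro image_eqI[of _ _ "(i mod int (q ^ m), k)"]) auto
      qed
    qed
    show ?thesis using hom inj surj unfolding is_iso_def iso_def bij_betw_def by blast
  qed
  ultimately show ?thesis using that q(1) m(2) K(1) by blast
qed

end

text \<open>
  The existence part of the structure theorem for finite abelian groups. It is needed since
  \<^const>\<open>K1_star\<close> has no meaningful value on a group without a decomposition.
\<close>

lemma exists_prime_power_decomposition: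
  assumes "finite_comm_group G"
  shows "\<exists>r p \<alpha>. prime_power_decomposition G r p \<alpha>"
  using assms
proof (induction "card (carrier G)" arbitrary: G rule: less_induct)
  case (less G)
  interpret finite_comm_group G by fact
  show ?case
  proof (cases "carrier G = {\<one>\<^bsub>G\<^esub>}")
    case True
    then show ?thesis using decomposition_trivial is_group by blast
  next
    case False
    then obtain q m K where K: "prime q" "m \<ge> 1" "subgroup K G" "card K < card (carrier G)"
      "integer_mod_group (q ^ m) \<times>\<times> G\<lparr>carrier := K\<rparr> \<cong> G" by (rule cyclic_summand)
    let ?K = "G\<lparr>carrier := K\<rparr>"
    have gK: "group ?K" using K(3) subgroup_imp_group by blast
    have KG: "K \<subseteq> carrier G" using K(3) subgroup.subset by blast
    have "comm_group ?K"
      by (rule group.group_comm_groupI[OF gK]) (use KG in \<open>auto intro: m_comm\<close>)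
    then have "finite_comm_group ?K"
      using finite_subset[OF KG finite_carrier] by (simp add: finite_comm_group_def finite_comm_group_axioms_def)
    then obtain r p \<alpha> where "prime_power_decomposition ?K r p \<alpha>" using less.hyps[of ?K] K(4) by auto
    then have dec: "prime_power_decomposition (integer_mod_group (q ^ m) \<times>\<times> ?K) (Suc r) (p(r := q)) (\<alpha>(r := m))"
      using decomposition_add_cyclic gK K(1,2) by blast
    have gP: "group (integer_mod_group (q ^ m) \<times>\<times> ?K)" using gK by (intro DirProd_group) auto
    have "G \<cong> integer_mod_group (q ^ m) \<times>\<times> ?K" using group.iso_sym[OF gP K(5)] .
    then show ?thesis using decomposition_cong_iso[OF _ dec] by blast
  qed
qed

section \<open>Adding a cyclic summand\<close>

lemma K1_star_add_cyclic:
  assumes G: "finite_comm_group G" and q: "prime q"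
  shows "K1_star (integer_mod_group (q ^ a) \<times>\<times> G) = (\<Sum>j<a. 1 / real q ^ j) + K1_star G"
proof -
  interpret finite_comm_group G by fact
  let ?P = "integer_mod_group (q ^ a) \<times>\<times> G"
  have gP: "group ?P" using is_group by (intro DirProd_group) auto
  obtain r p \<alpha> where dec: "prime_power_decomposition G r p \<alpha>"
    using exists_prime_power_decomposition[OF G] by blast
  show ?thesis
  proof (cases "a = 0")
    case True
    have "snd \<in> iso ?P G"
      using True by (auto simp: iso_def bij_betw_def inj_on_def snd_hom carrier_integer_mod_group)
    then have "?P \<cong> G" by (auto simp: is_iso_def)
    then have "prime_power_decomposition ?P r p \<alpha>" using decomposition_cong_iso dec by blast
    then show ?thesis using K1_star_eq gP is_group dec True by (simp add: K1_star_eq)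
  next
    case False
    then have "prime_power_decomposition ?P (Suc r) (p(r := q)) (\<alpha>(r := a))"
      using decomposition_add_cyclic[OF is_group dec q] by simp
    then have "K1_star ?P = (\<Sum>i<Suc r. cyclic_cross ((p(r := q)) i) ((\<alpha>(r := a)) i))"
      by (rule K1_star_eq[OF gP])
    also have "\<dots> = (\<Sum>i<r. cyclic_cross (p i) (\<alpha> i)) + cyclic_cross q a" by simp
    finally show ?thesis
      using False K1_star_eq[OF is_group dec] cyclic_cross_eq_sum[of q a] prime_gt_1_nat[OF q] by simp
  qed
qed

theorem theorem10:
  fixes G :: "('a, 'b) monoid_scheme" and p :: nat
  assumes "comm_group G" and "finite (carrier G)"
    and "prime p" and "p \<prec>\<^sub>2 group_exponent G"
  shows "(\<forall>\<alpha>::nat. K1 (integer_mod_group (p ^ \<alpha>) \<times>\<times> G)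
                    = K1 (integer_mod_group (p ^ \<alpha>)) + K1 G) \<and>
         (K1 G = K1_star G \<longrightarrow>
            (\<forall>\<alpha>::nat. K1 (integer_mod_group (p ^ \<alpha>) \<times>\<times> G)
                       = K1_star (integer_mod_group (p ^ \<alpha>) \<times>\<times> G)))"
proof -
  have G: "finite_comm_group G"
    using assms by (simp add: finite_comm_group_def finite_comm_group_axioms_def)
  show ?thesis
    using K1_add_cyclic[OF G assms(4)] K1_star_add_cyclic[OF G assms(3)] K1_cyclic_prime_power[OF assms(3)]
    by simp
qed

end
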